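(* Let $d\ge1$, let $\psi$ be an admissible modulus and $\varphi$ an admissible order function (see context), and suppose $I_\psi\subset(0,1)$ and $I_{\varphi\psi}\subset(0,1)\cup(1,2)\cup(2,3)$. Let $a_0:\mathbb{R}^d\setminus\{0\}\to[\Lambda_1,\Lambda_2]$ be measurable, where $0<\Lambda_1\le\Lambda_2$. Define, for continuous $u:\mathbb{R}^d\to\mathbb{R}$ for which the integral is well defined at every point $x$, $$\mathcal{L}_0u(x)=\int_{\mathbb{R}^d}\big(u(x+h)-u(x)-\nabla u(x)\cdot h\,\mathbb{1}_{\{|h|\le1\}}\big)\frac{a_0(h)}{|h|^d\varphi(|h|)}\,dh\quad\text{if }M_\varphi\in[1,2),$$ $$\mathcal{L}_0u(x)=\int_{\mathbb{R}^d}\big(u(x+h)-u(x)\big)\frac{a_0(h)}{|h|^d\varphi(|h|)}\,dh\quad\text{if }M_\varphi\in(0,1).$$ Then there exists a constant $C_1$ such that for all $u\in C^{\varphi\psi}(\mathbb{R}^d)\cap C_\infty(\mathbb{R}^d)$ and $f\in C^\psi(\mathbb{R}^d)$ satisfying $\mathcal{L}_0u=f$ on $\mathbb{R}^d$, $$\|u\|_{C^{\varphi\psi}}\le C_1\big(\|u\|_{C^0}+\|f\|_{C^\psi}\big).$$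
   Context: $\mathbb{N}=\{1,2,\dots\}$, $\mathbb{N}_0=\mathbb{N}\cup\{0\}$. $C_\infty(\mathbb{R}^d)$: continuous functions vanishing at infinity. A function $g:(0,1]\to(0,\infty)$ is almost increasing if there is $c\in(0,1]$ with $c\,g(r)\le g(R)$ for all $0<r\le R\le1$, and almost decreasing if there is $C\ge1$ with $g(R)\le C g(r)$ for all $0<r\le R\le1$. For $g:(0,1]\to(0,\infty)$ define $M_g=\inf\{\alpha\in\mathbb{R}: r\mapsto g(r)/r^\alpha\text{ is almost decreasing on }(0,1]\}$, $m_g=\sup\{\alpha\in\mathbb{R}: r\mapsto g(r)/r^\alpha\text{ is almost increasing on }(0,1]\}$, $I_g=[m_g,M_g]$. An admissible modulus is $\psi:(0,1]\to(0,\infty)$ with $\psi(1)=1$ and $\lim_{r\to0+}\psi(r)=0$. An admissible order function is a smooth $\varphi:(0,\infty)\to(0,\infty)$ with $\varphi(1)=1$ such that $\phi(r):=\varphi(r^{-1/2})^{-1}$ is a Bernstein function (i.e. $\phi\ge0$ is $C^\infty$ on $(0,\infty)$ with $(-1)^n\phi^{(n)}\le0$ for all $n\in\mathbb{N}$) and there are constants $0<\delta_1\le\delta_2<1$, $a_1\in(0,1]$, $a_2\in[1,\infty)$ with $a_1\lambda^{2\delta_1}\varphi(r)\le\varphi(\lambda r)\le a_2\lambda^{2\delta_2}\varphi(r)$ for all $\lambda\ge1$, $r>0$. The indices $M_\varphi,m_\varphi,I_\varphi$ refer to the restriction of $\varphi$ to $(0,1]$, and $\varphi\psi$ denotes the product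 function $r\mapsto\varphi(r)\psi(r)$ on $(0,1]$. Function spaces: $C^0(\mathbb{R}^d)$ is the space of bounded continuous functions with $\|f\|_{C^0}=\sup|f|$. For a multi-index $\gamma$, $D^\gamma f$ is the corresponding partial derivative; $\|D^jf\|_{C^0}$ denotes the maximum of $\|D^\gamma f\|_{C^0}$ over $|\gamma|=j$ (with $D^0f=f$). For $g:(0,1]\to(0,\infty)$ and $j\in\mathbb{N}_0$, $[f]_{C^{-j;g}}=\sup_{x\in\mathbb{R}^d}\sup_{0<|h|\le1}\frac{|f(x+h)-f(x)|}{g(|h|)|h|^{-j}}$, and $[D^kf]_{C^{-k;g}}$ is the maximum over $|\gamma|=k$ of $[D^\gamma f]_{C^{-k;g}}$. If $m_g\in(k,k+1]$ with $k\in\mathbb{N}_0$, then $C^g(\mathbb{R}^d)$ is the set of continuous $f$ such that all $D^\gamma f$ with $|\gamma|\le k$ exist and lie in $C^0(\mathbb{R}^d)$ and $[D^\gamma f]_{C^{-k;g}}<\infty$ for all $|\gamma|=k$, normed by $\|f\|_{C^g}=\sum_{j=0}^k\|D^jf\|_{C^0}+[D^kf]_{C^{-k;g}}$. *)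

theory Defs
  imports "HOL-Analysis.Analysis" "HOL-Library.Extended_Real"
begin

definition almost_increasing :: "(real \<Rightarrow> real) \<Rightarrow> bool" where
  "almost_increasing g \<longleftrightarrow>
     (\<exists>c. 0 < c \<and> c \<le> 1 \<and> (\<forall>r R. 0 < r \<and> r \<le> R \<and> R \<le> 1 \<longrightarrow> c * g r \<le> g R))"

definition almost_decreasing :: "(real \<Rightarrow> real) \<Rightarrow> bool" where
  "almost_decreasing g \<longleftrightarrow>
     (\<exists>C. 1 \<le> C \<and> (\<forall>r R. 0 < r \<and> r \<le> R \<and> R \<le> 1 \<longrightarrow> g R \<le> C * g r))"

text \<open>Upper and lower indices, taken in the extended reals (inf of the empty set is +\<infinity>, etc.).\<close>
definition upper_index :: "(real \<Rightarrow> real) \<Rightarrow> ereal" where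
  "upper_index g = Inf (ereal ` {\<alpha>. almost_decreasing (\<lambda>r. g r / r powr \<alpha>)})"

definition lower_index :: "(real \<Rightarrow> real) \<Rightarrow> ereal" where
  "lower_index g = Sup (ereal ` {\<alpha>. almost_increasing (\<lambda>r. g r / r powr \<alpha>)})"

definition index_interval :: "(real \<Rightarrow> real) \<Rightarrow> ereal set" where
  "index_interval g = {lower_index g .. upper_index g}"

definition admissible_modulus :: "(real \<Rightarrow> real) \<Rightarrow> bool" where
  "admissible_modulus \<psi> \<longleftrightarrow> (\<forall>r. 0 < r \<and> r \<le> 1 \<longrightarrow> 0 < \<psi> r) \<and> \<psi> 1 = 1 \<and> (\<psi> \<longlongrightarrow> 0) (at_right 0)"

definition smooth_pos :: "(real \<Rightarrow> real) \<Rightarrow> bool" where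
  "smooth_pos f \<longleftrightarrow> (\<forall>n r. 0 < r \<longrightarrow> (deriv ^^ n) f field_differentiable (at r))"

definition bernstein :: "(real \<Rightarrow> real) \<Rightarrow> bool" where
  "bernstein \<phi> \<longleftrightarrow> (\<forall>r>0. 0 \<le> \<phi> r) \<and> smooth_pos \<phi> \<and>
     (\<forall>n r. 1 \<le> n \<and> 0 < r \<longrightarrow> (-1) ^ n * (deriv ^^ n) \<phi> r \<le> 0)"

definition admissible_order :: "(real \<Rightarrow> real) \<Rightarrow> bool" where
  "admissible_order \<phi> \<longleftrightarrow> (\<forall>r>0. 0 < \<phi> r) \<and> smooth_pos \<phi> \<and> \<phi> 1 = 1 \<and>
     bernstein (\<lambda>r. inverse (\<phi> (r powr (-1/2)))) \<and>
     (\<exists>\<delta>1 \<delta>2 a1 a2. 0 < \<delta>1 \<and> \<delta>1 \<le> \<delta>2 \<and> \<delta>2 < 1 \<and> 0 < a1 \<and> a1 \<le> 1 \<and> 1 \<le> a2 \<and>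
        (\<forall>lam r. 1 \<le> lam \<and> 0 < r \<longrightarrow>
           a1 * lam powr (2*\<delta>1) * \<phi> r \<le> \<phi> (lam * r) \<and>
           \<phi> (lam * r) \<le> a2 * lam powr (2*\<delta>2) * \<phi> r))"

definition has_pderiv :: "'a::euclidean_space \<Rightarrow> ('a \<Rightarrow> real) \<Rightarrow> 'a \<Rightarrow> bool" where
  "has_pderiv b f x \<longleftrightarrow> (\<exists>D. ((\<lambda>t. f (x + t *\<^sub>R b)) has_real_derivative D) (at 0))"

definition pderiv :: "'a::euclidean_space \<Rightarrow> ('a \<Rightarrow> real) \<Rightarrow> 'a \<Rightarrow> real" where
  "pderiv b f x = deriv (\<lambda>t. f (x + t *\<^sub>R b)) 0"

fun Dl :: "'a::euclidean_space list \<Rightarrow> ('a \<Rightarrow> real) \<Rightarrow> 'a \<Rightarrow> real" where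
  "Dl [] f = f"
| "Dl (b # bs) f = pderiv b (Dl bs f)"

definition multi_idx :: "nat \<Rightarrow> 'a::euclidean_space list set" where
  "multi_idx j = {bs. set bs \<subseteq> Basis \<and> length bs = j}"

definition sup_norm :: "('a \<Rightarrow> real) \<Rightarrow> real" where
  "sup_norm f = (SUP x. \<bar>f x\<bar>)"

definition bounded_cont :: "('a::topological_space \<Rightarrow> real) \<Rightarrow> bool" where
  "bounded_cont f \<longleftrightarrow> continuous_on UNIV f \<and> bounded (range f)"

definition hq_set :: "(real \<Rightarrow> real) \<Rightarrow> nat \<Rightarrow> ('a::euclidean_space \<Rightarrow> real) \<Rightarrow> real set" where
  "hq_set g j f = {\<bar>f (x + h) - f x\<bar> / (g (norm h) * norm h powr (- real j)) | x h. 0 < norm h \<and> norm h \<le> 1}"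

definition hseminorm :: "(real \<Rightarrow> real) \<Rightarrow> nat \<Rightarrow> ('a::euclidean_space \<Rightarrow> real) \<Rightarrow> real" where
  "hseminorm g j f = Sup (hq_set g j f)"

definition horder :: "(real \<Rightarrow> real) \<Rightarrow> nat" where
  "horder g = (THE k::nat. ereal (real k) < lower_index g \<and> lower_index g \<le> ereal (real k + 1))"

definition hoelder_space :: "(real \<Rightarrow> real) \<Rightarrow> ('a::euclidean_space \<Rightarrow> real) set" where
  "hoelder_space g = {f. (\<exists>k::nat. ereal (real k) < lower_index g \<and> lower_index g \<le> ereal (real k + 1)) \<and>
      continuous_on UNIV f \<and>
      (\<forall>j \<le> horder g. \<forall>bs \<in> multi_idx j.
          (\<forall>x. bs \<noteq> [] \<longrightarrow> has_pderiv (hd bs) (Dl (tl bs) f) x) \<and> bounded_cont (Dl bs f)) \<and>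
      (\<forall>bs \<in> multi_idx (horder g). bdd_above (hq_set g (horder g) (Dl bs f)))}"

definition hnorm :: "(real \<Rightarrow> real) \<Rightarrow> ('a::euclidean_space \<Rightarrow> real) \<Rightarrow> real" where
  "hnorm g f = (\<Sum>j\<le>horder g. Max ((\<lambda>bs. sup_norm (Dl bs f)) ` multi_idx j))
      + Max ((\<lambda>bs. hseminorm g (horder g) (Dl bs f)) ` multi_idx (horder g))"

definition vanishes_at_infinity :: "('a::real_normed_vector \<Rightarrow> real) \<Rightarrow> bool" where
  "vanishes_at_infinity u \<longleftrightarrow> continuous_on UNIV u \<and> (u \<longlongrightarrow> 0) at_infinity"

definition kernel :: "('a::euclidean_space \<Rightarrow> real) \<Rightarrow> (real \<Rightarrow> real) \<Rightarrow> 'a \<Rightarrow> real" where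
  "kernel a0 \<phi> h = a0 h / (norm h ^ DIM('a) * \<phi> (norm h))"

definition grad_dot :: "('a::euclidean_space \<Rightarrow> real) \<Rightarrow> 'a \<Rightarrow> 'a \<Rightarrow> real" where
  "grad_dot u x h = (\<Sum>b\<in>Basis. pderiv b u x * (h \<bullet> b))"

definition L0_integrand :: "('a::euclidean_space \<Rightarrow> real) \<Rightarrow> (real \<Rightarrow> real) \<Rightarrow> ('a \<Rightarrow> real) \<Rightarrow> 'a \<Rightarrow> 'a \<Rightarrow> real" where
  "L0_integrand a0 \<phi> u x h =
     (if upper_index \<phi> \<in> {1..<2} then
        (u (x + h) - u x - (if norm h \<le> 1 then grad_dot u x h else 0)) * kernel a0 \<phi> h
      else (u (x + h) - u x) * kernel a0 \<phi> h)"

definition L0_defined :: "('a::euclidean_space \<Rightarrow> real) \<Rightarrow> (real \<Rightarrow> real) \<Rightarrow> ('a \<Rightarrow> real) \<Rightarrow> 'a \<Rightarrow> bool" where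
  "L0_defined a0 \<phi> u x \<longleftrightarrow>
     (upper_index \<phi> \<in> {1..<2} \<or> upper_index \<phi> \<in> {0<..<1}) \<and>
     (upper_index \<phi> \<in> {1..<2} \<longrightarrow> (\<forall>b\<in>Basis. has_pderiv b u x)) \<and>
     integrable lebesgue (L0_integrand a0 \<phi> u x)"

definition L0 :: "('a::euclidean_space \<Rightarrow> real) \<Rightarrow> (real \<Rightarrow> real) \<Rightarrow> ('a \<Rightarrow> real) \<Rightarrow> 'a \<Rightarrow> real" where
  "L0 a0 \<phi> u x = integral\<^sup>L lebesgue (L0_integrand a0 \<phi> u x)"

end

theory Submission
  imports Defs
begin

text \<open>
  The estimate is obtained from the maximum principle alone. Let \<open>v\<close> be a derivative of \<open>u\<close> of top
  order \<open>k\<close>, let \<open>W\<close> be the corresponding difference quotient of step \<open>\<rho> \<sim> \<delta> |h|\<close>, and let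
  \<open>w x = W (x + h) - W x\<close>, which vanishes at infinity and solves the equation with the differenced right-hand side.
  At a maximum \<open>x0\<close> of \<open>w\<close> the gradient vanishes, so the equation controls
  \<open>w x0 - w (x0 + y)\<close> integrated over each of the balls of radius \<open>|h|\<close> around \<open>j h\<close>, \<open>j < N\<close>. Summing over \<open>j\<close>
  telescopes, and \<open>N * w x0\<close> is at most the oscillation of \<open>W\<close> at distance \<open>N |h|\<close> plus a multiple of
  \<open>\<phi> |h|\<close> times the size of the right-hand side. Since the index of \<open>\<phi> \<psi>\<close> lies strictly between \<open>k\<close> and \<open>k + 1\<close>,
  dividing by \<open>N\<close> makes the coefficient of the seminorm of \<open>v\<close> small for large \<open>N\<close> and
  small \<open>\<delta>\<close>; being finite, the seminorm can be absorbed.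
\<close>

subsection \<open>Finite differences and partial derivatives\<close>

definition shift_diff :: "'a::euclidean_space \<Rightarrow> ('a \<Rightarrow> real) \<Rightarrow> 'a \<Rightarrow> real" where
  "shift_diff a u x = u (x + a) - u x"

text \<open>The head direction is differenced first, whereas \<open>Dl\<close> differentiates in it
  last. This order suits inductions that generalise over \<open>u\<close>, and it is harmless
  because differences commute with each other and with existing derivatives.\<close>

fun iter_diff :: "real \<Rightarrow> 'a::euclidean_space list \<Rightarrow> ('a \<Rightarrow> real) \<Rightarrow> 'a \<Rightarrow> real" where
  "iter_diff \<rho> [] u = u"
| "iter_diff \<rho> (b # bs) u = iter_diff \<rho> bs (shift_diff (\<rho> *\<^sub>R b) u)"

text \<open>\<open>Dl\<close> is built on the total function \<open>deriv\<close>, so its values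
  alone do not witness differentiability; this predicate records that each derivative taken along
  the list exists.\<close>

fun pdiff :: "'a::euclidean_space list \<Rightarrow> ('a \<Rightarrow> real) \<Rightarrow> bool" where
  "pdiff [] u \<longleftrightarrow> True"
| "pdiff (b # bs) u \<longleftrightarrow> pdiff bs u \<and> (\<forall>x. has_pderiv b (Dl bs u) x)"

lemma has_pderiv_iff:
  "has_pderiv b u x \<longleftrightarrow> ((\<lambda>t. u (x + t *\<^sub>R b)) has_real_derivative pderiv b u x) (at 0)"
  unfolding has_pderiv_def pderiv_def using DERIV_imp_deriv by blast

lemma has_pderiv_shift_diff:
  assumes "has_pderiv b u x" "has_pderiv b u (x + a)"
  shows "has_pderiv b (shift_diff a u) x"
    and "pderiv b (shift_diff a u) x = pderiv b u (x + a) - pderiv b u x"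
proof -
  have "((\<lambda>t. u (x + a + t *\<^sub>R b) - u (x + t *\<^sub>R b)) has_real_derivative
      (pderiv b u (x + a) - pderiv b u x)) (at 0)"
    using assms unfolding has_pderiv_iff by (intro DERIV_diff)
  then have *: "((\<lambda>t. shift_diff a u (x + t *\<^sub>R b)) has_real_derivative
      (pderiv b u (x + a) - pderiv b u x)) (at 0)"
    by (simp add: shift_diff_def algebra_simps)
  then show "has_pderiv b (shift_diff a u) x" unfolding has_pderiv_def by blast
  show "pderiv b (shift_diff a u) x = pderiv b u (x + a) - pderiv b u x"
    unfolding pderiv_def[of b "shift_diff a u"] by (rule DERIV_imp_deriv[OF *])
qed

lemma has_pderiv_line:
  assumes "\<And>x. has_pderiv b u x"
  shows "((\<lambda>t. u (x + t *\<^sub>R b)) has_real_derivative pderiv b u (x + s *\<^sub>R b)) (at s)"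
proof -
  have "((\<lambda>t. u (x + s *\<^sub>R b + t *\<^sub>R b)) has_real_derivative pderiv b u (x + s *\<^sub>R b)) (at 0)"
    using assms has_pderiv_iff by blast
  then have "((\<lambda>t. u (x + (t + s) *\<^sub>R b)) has_real_derivative pderiv b u (x + s *\<^sub>R b)) (at 0)"
    by (simp add: algebra_simps)
  then show ?thesis
    using DERIV_shift[of "\<lambda>t. u (x + t *\<^sub>R b)" "pderiv b u (x + s *\<^sub>R b)" 0 s] by simp
qed

lemma shift_diff_mvt:
  assumes "\<And>x. has_pderiv b u x" "0 < \<rho>"
  obtains s where "0 < s" "s < \<rho>" "shift_diff (\<rho> *\<^sub>R b) u x = \<rho> * pderiv b u (x + s *\<^sub>R b)"
proof -
  obtain s where "0 < s" "s < \<rho>"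
    "u (x + \<rho> *\<^sub>R b) - u (x + 0 *\<^sub>R b) = (\<rho> - 0) * pderiv b u (x + s *\<^sub>R b)"
    using MVT2[OF assms(2), of "\<lambda>t. u (x + t *\<^sub>R b)" "\<lambda>s. pderiv b u (x + s *\<^sub>R b)"]
      has_pderiv_line[OF assms(1)] by blast
  then show thesis using that by (simp add: shift_diff_def)
qed

lemma Dl_shift_diff:
  assumes "pdiff bs u"
  shows "pdiff bs (shift_diff a u) \<and> Dl bs (shift_diff a u) = shift_diff a (Dl bs u)"
  using assms
proof (induction bs)
  case (Cons b bs)
  then have "\<And>x. has_pderiv b (shift_diff a (Dl bs u)) x"
    "\<And>x. pderiv b (shift_diff a (Dl bs u)) x = shift_diff a (pderiv b (Dl bs u)) x"
    by (auto simp: has_pderiv_shift_diff shift_diff_def[of _ "pderiv b (Dl bs u)"])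
  with Cons show ?case by auto
qed simp

lemma shift_diff_commute: "shift_diff a (shift_diff b u) = shift_diff b (shift_diff a u)"
  by (auto simp: shift_diff_def fun_eq_iff algebra_simps)

lemma iter_diff_shift_diff: "iter_diff \<rho> bs (shift_diff a u) = shift_diff a (iter_diff \<rho> bs u)"
  by (induction bs arbitrary: u) (simp_all add: shift_diff_commute)

lemma iter_diff_bound:
  assumes "\<And>x. \<bar>u x\<bar> \<le> U"
  shows "\<bar>iter_diff \<rho> bs u x\<bar> \<le> 2 ^ length bs * U"
  using assms
proof (induction bs arbitrary: u U)
  case (Cons b bs)
  have "\<bar>shift_diff (\<rho> *\<^sub>R b) u y\<bar> \<le> 2 * U" for y
    unfolding shift_diff_def using Cons.prems[of y] Cons.prems[of "y + \<rho> *\<^sub>R b"] by linarith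
  from Cons.IH[OF this] show ?case by (simp add: mult.assoc mult.left_commute)
qed simp

text \<open>Iterated mean value theorem: the difference in the head direction passes through the
  remaining derivatives and then becomes \<open>\<rho>\<close> times a derivative. Basis vectors
  have norm 1, so each application moves the point by at most \<open>\<rho>\<close>.\<close>

lemma iter_diff_mvt:
  assumes "pdiff bs u" "set bs \<subseteq> Basis" "0 < \<rho>"
  shows "\<exists>y. norm (y - x) \<le> real (length bs) * \<rho> \<and> iter_diff \<rho> bs u x = \<rho> ^ length bs * Dl bs u y"
  using assms
proof (induction bs arbitrary: u)
  case (Cons b bs)
  have D: "pdiff bs (shift_diff (\<rho> *\<^sub>R b) u)"
    "Dl bs (shift_diff (\<rho> *\<^sub>R b) u) = shift_diff (\<rho> *\<^sub>R b) (Dl bs u)"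
    using Dl_shift_diff Cons.prems by auto
  obtain y where y: "norm (y - x) \<le> real (length bs) * \<rho>"
    "iter_diff \<rho> bs (shift_diff (\<rho> *\<^sub>R b) u) x = \<rho> ^ length bs * shift_diff (\<rho> *\<^sub>R b) (Dl bs u) y"
    using Cons.IH[OF D(1)] Cons.prems D(2) by auto
  obtain s where s: "0 < s" "s < \<rho>"
    "shift_diff (\<rho> *\<^sub>R b) (Dl bs u) y = \<rho> * pderiv b (Dl bs u) (y + s *\<^sub>R b)"
    using shift_diff_mvt[of b "Dl bs u" \<rho> y] Cons.prems by auto
  have "norm (y + s *\<^sub>R b - x) \<le> norm (y - x) + norm (s *\<^sub>R b)"
    using norm_triangle_ineq[of "y - x" "s *\<^sub>R b"] by (simp add: algebra_simps)
  also have "\<dots> \<le> real (length (b # bs)) * \<rho>"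
    using y(1) s Cons.prems(2) by (simp add: algebra_simps)
  finally show ?case using y s by (intro exI[of _ "y + s *\<^sub>R b"]) simp
qed simp

subsection \<open>The equation and its maximum principle\<close>

text \<open>Decay at infinity is bundled with the equation because both survive differencing and
  scaling and the maximum principle uses both. \<open>L0_defined\<close> is kept since a
  non-integrable function has Bochner integral 0 by default.\<close>

definition solves :: "('a::euclidean_space \<Rightarrow> real) \<Rightarrow> (real \<Rightarrow> real) \<Rightarrow> ('a \<Rightarrow> real) \<Rightarrow> ('a \<Rightarrow> real) \<Rightarrow> bool" where
  "solves a0 \<phi> u f \<longleftrightarrow> vanishes_at_infinity u \<and> (\<forall>x. L0_defined a0 \<phi> u x \<and> L0 a0 \<phi> u x = f x)"

lemma vanishes_at_infinity_shift_diff: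
  assumes "vanishes_at_infinity u"
  shows "vanishes_at_infinity (shift_diff a u)"
proof -
  have c: "continuous_on UNIV u" and l: "(u \<longlongrightarrow> 0) at_infinity"
    using assms by (auto simp: vanishes_at_infinity_def)
  have "filterlim (\<lambda>x. a + x) at_infinity (at_infinity :: 'a filter)"
    by (intro tendsto_add_filterlim_at_infinity[of _ a] tendsto_const filterlim_ident)
  then have "((\<lambda>x. u (a + x)) \<longlongrightarrow> 0) at_infinity" using filterlim_compose[OF l] by blast
  from tendsto_diff[OF this l] have "(shift_diff a u \<longlongrightarrow> 0) at_infinity"
    by (simp add: shift_diff_def[abs_def] add.commute)
  moreover have "continuous_on UNIV (shift_diff a u)"
    unfolding shift_diff_def[abs_def]
    by (intro continuous_intros continuous_on_compose2[OF c] c) auto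
  ultimately show ?thesis by (simp add: vanishes_at_infinity_def)
qed

text \<open>The kernel depends on the jump only and not on the base point, so the operator is linear
  and commutes with translations.\<close>

lemma solves_shift_diff:
  assumes "solves a0 \<phi> u f"
  shows "solves a0 \<phi> (shift_diff a u) (shift_diff a f)"
proof -
  have u: "vanishes_at_infinity u" and d: "\<And>x. L0_defined a0 \<phi> u x" and L: "\<And>x. L0 a0 \<phi> u x = f x"
    using assms by (auto simp: solves_def)
  \<comment> \<open>Partial derivatives are only known to exist in the range of indices where the
    gradient term is present; this is also the only range where they are needed.\<close>
  have p: "has_pderiv b u x" if "upper_index \<phi> \<in> {1..<2}" "b \<in> Basis" for b x
    using d[of x] that by (auto simp: L0_defined_def)
  have I: "L0_integrand a0 \<phi> (shift_diff a u) x = (\<lambda>h. L0_integrand a0 \<phi> u (x + a) h - L0_integrand a0 \<phi> u x h)" for x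
  proof (cases "upper_index \<phi> \<in> {1..<2}")
    case True
    have "grad_dot (shift_diff a u) x h = grad_dot u (x + a) h - grad_dot u x h" for h
      unfolding grad_dot_def sum_subtractf[symmetric]
      by (intro sum.cong refl) (simp add: has_pderiv_shift_diff p[OF True] algebra_simps)
    note gd = this
    show ?thesis unfolding L0_integrand_def gd fun_eq_iff
      using True by (auto simp: shift_diff_def algebra_simps)
  next
    case False
    then show ?thesis by (auto simp: L0_integrand_def fun_eq_iff shift_diff_def algebra_simps)
  qed
  have i: "integrable lebesgue (L0_integrand a0 \<phi> u x)" for x using d[of x] by (simp add: L0_defined_def)
  have "L0_defined a0 \<phi> (shift_diff a u) x" for x
    using d[of x] p unfolding L0_defined_def I by (auto intro: has_pderiv_shift_diff i)
  moreover have "L0 a0 \<phi> (shift_diff a u) x = shift_diff a f x" for x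
    unfolding L0_def I using i by (simp add: shift_diff_def L[symmetric] L0_def)
  ultimately show ?thesis
    using u by (simp add: solves_def vanishes_at_infinity_shift_diff)
qed

lemma solves_iter_diff:
  "solves a0 \<phi> u f \<Longrightarrow> solves a0 \<phi> (iter_diff \<rho> bs u) (iter_diff \<rho> bs f)"
  by (induction bs arbitrary: u f) (auto intro: solves_shift_diff)

lemma solves_scale:
  assumes "solves a0 \<phi> u f"
  shows "solves a0 \<phi> (\<lambda>x. c * u x) (\<lambda>x. c * f x)"
proof -
  have u: "vanishes_at_infinity u" and d: "\<And>x. L0_defined a0 \<phi> u x" and L: "\<And>x. L0 a0 \<phi> u x = f x"
    using assms by (auto simp: solves_def)
  have p: "((\<lambda>t. c * u (x + t *\<^sub>R b)) has_real_derivative c * pderiv b u x) (at 0)"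
    if "upper_index \<phi> \<in> {1..<2}" "b \<in> Basis" for b x
    using d[of x] that by (auto simp: L0_defined_def has_pderiv_iff intro!: DERIV_cmult)
  then have q: "pderiv b (\<lambda>x. c * u x) x = c * pderiv b u x"
    if "upper_index \<phi> \<in> {1..<2}" "b \<in> Basis" for b x
    unfolding pderiv_def[of b "\<lambda>x. c * u x"] using that by (intro DERIV_imp_deriv)
  have I: "L0_integrand a0 \<phi> (\<lambda>x. c * u x) x = (\<lambda>h. c * L0_integrand a0 \<phi> u x h)" for x
  proof (cases "upper_index \<phi> \<in> {1..<2}")
    case True
    have "grad_dot (\<lambda>x. c * u x) x h = c * grad_dot u x h" for h
      unfolding grad_dot_def sum_distrib_left
      by (intro sum.cong refl) (simp add: q[OF True] algebra_simps)
    with True show ?thesis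
      by (auto simp: L0_integrand_def fun_eq_iff algebra_simps)
  next
    case False
    then show ?thesis by (auto simp: L0_integrand_def fun_eq_iff algebra_simps)
  qed
  have i: "integrable lebesgue (L0_integrand a0 \<phi> u x)" for x using d[of x] by (simp add: L0_defined_def)
  have "L0_defined a0 \<phi> (\<lambda>x. c * u x) x" for x
    using d[of x] p i unfolding L0_defined_def I by (auto simp: has_pderiv_def)
  moreover have "L0 a0 \<phi> (\<lambda>x. c * u x) x = c * f x" for x
    unfolding L0_def I by (simp add: L[symmetric] L0_def)
  moreover have "vanishes_at_infinity (\<lambda>x. c * u x)"
    using u tendsto_mult_right_zero[of u at_infinity c]
    by (auto simp: vanishes_at_infinity_def intro!: continuous_intros)
  ultimately show ?thesis by (simp add: solves_def)
qed

text \<open>Outside a large ball \<open>w\<close> stays below the positive value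
  \<open>w x1\<close>, so the maximum over a closed ball that also contains \<open>x1\<close> is
  global. Without a positive value the supremum 0 might not be attained.\<close>

lemma vanishes_at_infinity_attains_max:
  fixes w :: "'a::euclidean_space \<Rightarrow> real"
  assumes "vanishes_at_infinity w" "0 < w x1"
  obtains x0 where "\<And>x. w x \<le> w x0"
proof -
  have c: "continuous_on UNIV w" and l: "(w \<longlongrightarrow> 0) at_infinity"
    using assms by (auto simp: vanishes_at_infinity_def)
  from order_tendstoD(2)[OF l assms(2)] obtain M where M: "\<And>x. M \<le> norm x \<Longrightarrow> w x < w x1"
    by (auto simp: eventually_at_infinity)
  have "\<exists>x\<in>cball 0 (max M (norm x1)). \<forall>y\<in>cball 0 (max M (norm x1)). w y \<le> w x"
    by (rule continuous_attains_sup[OF compact_cball]) (auto intro: continuous_on_subset[OF c])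
  then obtain x0 where "\<forall>y\<in>cball 0 (max M (norm x1)). w y \<le> w x0" by blast
  then have x0: "\<And>y. norm y \<le> max M (norm x1) \<Longrightarrow> w y \<le> w x0" by (metis mem_cball_0)
  have "w y \<le> w x0" for y
  proof (cases "norm y \<le> max M (norm x1)")
    case False
    then have "w y < w x1" by (intro M) simp
    also have "w x1 \<le> w x0" by (intro x0) simp
    finally show ?thesis by simp
  qed (rule x0)
  then show thesis by (rule that)
qed

text \<open>At a maximum all partial derivatives vanish. The compensator drops out and both forms of
  the operator reduce to one integral, in which \<open>w x0 - w (x0 + h)\<close> is
  nonnegative.\<close>

lemma solves_at_max:
  assumes "solves a0 \<phi> w g" and max: "\<And>x. w x \<le> w x0"
  shows "has_bochner_integral lebesgue (\<lambda>h. (w x0 - w (x0 + h)) * kernel a0 \<phi> h) (- g x0)"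
proof -
  have d: "L0_defined a0 \<phi> w x0" and L: "L0 a0 \<phi> w x0 = g x0" using assms by (auto simp: solves_def)
  have I: "L0_integrand a0 \<phi> w x0 = (\<lambda>h. - ((w x0 - w (x0 + h)) * kernel a0 \<phi> h))"
  proof (cases "upper_index \<phi> \<in> {1..<2}")
    case True
    have "pderiv b w x0 = 0" if "b \<in> Basis" for b
    proof (rule DERIV_local_max)
      show "((\<lambda>t. w (x0 + t *\<^sub>R b)) has_real_derivative pderiv b w x0) (at 0)"
        using d True that by (auto simp: L0_defined_def has_pderiv_iff)
    qed (use max in \<open>auto intro: zero_less_one\<close>)
    then have "grad_dot w x0 h = 0" for h by (simp add: grad_dot_def)
    then show ?thesis by (auto simp: L0_integrand_def fun_eq_iff algebra_simps)
  next
    case False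
    then show ?thesis by (auto simp: L0_integrand_def fun_eq_iff algebra_simps)
  qed
  have "integrable lebesgue (L0_integrand a0 \<phi> w x0)" using d by (simp add: L0_defined_def)
  then show ?thesis using L unfolding L0_def I by (auto simp: has_bochner_integral_iff)
qed

lemma lborel_integral_translate:
  fixes f :: "'a::euclidean_space \<Rightarrow> real"
  assumes "f \<in> borel_measurable borel"
  shows "integral\<^sup>L lborel (\<lambda>x. f (c + x)) = integral\<^sup>L lborel f"
proof -
  have "integral\<^sup>L lborel f = integral\<^sup>L (distr lborel borel ((+) c)) f" by (simp add: lborel_distr_plus)
  also have "\<dots> = integral\<^sup>L lborel (\<lambda>x. f (c + x))"
    by (rule integral_distr) (use assms in auto)
  finally show ?thesis by simp
qed

text \<open>Comparing \<open>w x0\<close> with \<open>N\<close> successive translates turns the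
  nonlocal equation into a bound on increments. The first term is the oscillation of
  \<open>W\<close> averaged over \<open>N\<close> steps; the second is the bound \<open>G\<close>
  times the inverse of the least kernel mass available on the balls used.\<close>

lemma shift_diff_le_oscillation:
  fixes W :: "'a::euclidean_space \<Rightarrow> real"
  assumes sol: "solves a0 \<phi> (shift_diff h W) g" and W: "continuous_on UNIV W"
    and \<phi>_pos: "\<And>r. 0 < r \<Longrightarrow> 0 < \<phi> r"
    and \<phi>_mono: "\<And>lam r. 1 \<le> lam \<Longrightarrow> 0 < r \<Longrightarrow> a1 * \<phi> r \<le> \<phi> (lam * r)" and a1: "0 < a1"
    and a0: "\<And>h. h \<noteq> 0 \<Longrightarrow> \<Lambda>1 \<le> a0 h" and \<Lambda>1: "0 < \<Lambda>1"
    and h: "h \<noteq> 0" and N: "0 < N"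
    and G: "\<And>x. \<bar>g x\<bar> \<le> G" and osc: "\<And>x. W (x + real N *\<^sub>R h) - W x \<le> osc" and osc_nonneg: "0 \<le> osc"
  shows "shift_diff h W x \<le> osc / N +
    (real N + 1) ^ DIM('a) * \<phi> ((real N + 1) * norm h) / (a1 * \<Lambda>1 * measure lborel (ball (0::'a) 1)) * G"
proof -
  define w where "w = shift_diff h W"
  define r where "r = norm h"
  define R where "R = (real N + 1) * r"
  \<comment> \<open>\<open>Q\<close> bounds \<open>norm y ^ DIM('a) * \<phi> (norm y)\<close> for
    nonzero \<open>y\<close> of norm at most \<open>R\<close>, by the almost monotonicity of
    \<open>\<phi>\<close>; hence the kernel is at least \<open>\<Lambda>1 / Q\<close> there.\<close>
  define Q where "Q = R ^ DIM('a) * \<phi> R / a1"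
  define \<omega> where "\<omega> = measure lborel (ball (0::'a) 1)"
  have r: "0 < r" using h by (simp add: r_def)
  have R: "0 < R" unfolding R_def using r by (simp add: add_nonneg_pos)
  have Q: "0 < Q" unfolding Q_def using R \<phi>_pos a1 by simp
  have \<omega>: "0 < \<omega>" unfolding \<omega>_def by simp
  have G0: "0 \<le> G" using G[of 0] by linarith
  have NQ: "(real N + 1) ^ DIM('a) * \<phi> ((real N + 1) * norm h) / (a1 * \<Lambda>1 * \<omega>) * G
     = Q / \<Lambda>1 * G / (\<omega> * r ^ DIM('a))"
    unfolding Q_def R_def r_def[symmetric] power_mult_distrib using r by simp
  have "w x \<le> osc / N + Q / \<Lambda>1 * G / (\<omega> * r ^ DIM('a))"
  proof (cases "w x \<le> 0")
    \<comment> \<open>Here no maximum needs to be found: the right-hand side is nonnegative.\<close>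
    case True
    have "0 \<le> osc / N + Q / \<Lambda>1 * G / (\<omega> * r ^ DIM('a))"
      using osc_nonneg Q \<Lambda>1 G0 \<omega> r by simp
    with True show ?thesis by linarith
  next
    case False
    have "vanishes_at_infinity w" using sol by (simp add: solves_def w_def)
    then obtain x0 where max: "\<And>y. w y \<le> w x0"
      using vanishes_at_infinity_attains_max[of w x] False by force
    define F where "F y = w x0 - w (x0 + y)" for y
    have F0: "0 \<le> F y" for y using max[of "x0 + y"] by (simp add: F_def)
    have cw: "continuous_on UNIV w"
      using sol by (simp add: solves_def w_def vanishes_at_infinity_def)
    have cF: "continuous_on UNIV F"
      unfolding F_def[abs_def] by (intro continuous_intros continuous_on_compose2[OF cw]) auto
    have bF[measurable]: "F \<in> borel_measurable borel" by (rule borel_measurable_continuous_onI[OF cF])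
    have K: "has_bochner_integral lebesgue (\<lambda>y. F y * kernel a0 \<phi> y) (- g x0)"
      using solves_at_max[of a0 \<phi> w g x0] sol max by (simp add: F_def w_def)
    \<comment> \<open>Each ball is compared with the integral over the whole space, whose integrand
      is nonnegative. The balls are treated one at a time, so their overlaps do not matter.\<close>
    have ball: "(\<integral>z. indicator (cball 0 r) z * F (real j *\<^sub>R h + z) \<partial>lborel) \<le> Q / \<Lambda>1 * G" if "j < N" for j
    proof -
      define f where "f y = indicator (cball (real j *\<^sub>R h) r) y * F y" for y
      have bf: "f \<in> borel_measurable borel" unfolding f_def[abs_def]
        by (intro borel_measurable_times borel_measurable_indicator bF) auto
      have "integrable lborel f"
        using borel_integrable_compact[OF compact_cball continuous_on_subset[OF cF], of "real j *\<^sub>R h" r]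
        by (simp add: f_def[abs_def])
      \<comment> \<open>The equation is an integral for \<open>lebesgue\<close>, while translation
        is carried out for \<open>lborel\<close>; since \<open>f\<close> is Borel, both give the
        same value.\<close>
      then have fi: "integrable lebesgue f" using bf by (simp add: integrable_completion)
      have "(\<integral>z. indicator (cball 0 r) z * F (real j *\<^sub>R h + z) \<partial>lborel) = (\<integral>z. f (real j *\<^sub>R h + z) \<partial>lborel)"
        by (intro Bochner_Integration.integral_cong refl) (auto simp: f_def dist_norm split: split_indicator)
      also have "\<dots> = integral\<^sup>L lborel f" by (rule lborel_integral_translate[OF bf])
      also have "\<dots> = integral\<^sup>L lebesgue f" using bf by (simp add: integral_completion)
      also have "\<dots> \<le> (\<integral>y. Q / \<Lambda>1 * (F y * kernel a0 \<phi> y) \<partial>lebesgue)"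
      proof (intro integral_mono fi)
        show "integrable lebesgue (\<lambda>y. Q / \<Lambda>1 * (F y * kernel a0 \<phi> y))"
          using K by (auto simp: has_bochner_integral_iff)
        fix y
        show "f y \<le> Q / \<Lambda>1 * (F y * kernel a0 \<phi> y)"
        proof (cases "y = 0")
          case True
          then show ?thesis by (simp add: f_def F_def)
        next
          case False
          have k0: "0 \<le> kernel a0 \<phi> y"
            unfolding kernel_def using a0[OF False] \<Lambda>1 \<phi>_pos[of "norm y"] False by simp
          show ?thesis
          proof (cases "y \<in> cball (real j *\<^sub>R h) r")
            case True
            have "norm y \<le> norm (real j *\<^sub>R h) + norm (y - real j *\<^sub>R h)"
              using norm_triangle_ineq[of "real j *\<^sub>R h" "y - real j *\<^sub>R h"] by simp
            also have "\<dots> \<le> real j * r + r" using True by (simp add: r_def dist_norm norm_minus_commute)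
            also have "\<dots> \<le> R" unfolding R_def using \<open>j < N\<close> r by (simp add: distrib_right mult_right_mono)
            finally have yR: "norm y \<le> R" .
            have "a1 * \<phi> (norm y) \<le> \<phi> (R / norm y * norm y)"
              using yR False by (intro \<phi>_mono) auto
            then have "\<phi> (norm y) \<le> \<phi> R / a1" using False a1 by (simp add: field_simps)
            then have "norm y ^ DIM('a) * \<phi> (norm y) \<le> R ^ DIM('a) * (\<phi> R / a1)"
              using yR R \<phi>_pos[of "norm y"] False by (intro mult_mono power_mono) auto
            then have "norm y ^ DIM('a) * \<phi> (norm y) \<le> Q" by (simp add: Q_def)
            then have "\<Lambda>1 / Q \<le> kernel a0 \<phi> y"
              unfolding kernel_def using a0[OF False] \<Lambda>1 \<phi>_pos[of "norm y"] False
              by (intro frac_le) auto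
            then have "1 \<le> Q / \<Lambda>1 * kernel a0 \<phi> y" using Q \<Lambda>1 by (simp add: field_simps)
            then have "F y * 1 \<le> F y * (Q / \<Lambda>1 * kernel a0 \<phi> y)" using F0 by (intro mult_left_mono)
            then show ?thesis using True by (simp add: f_def mult.left_commute)
          next
            case False
            then show ?thesis using k0 F0 Q \<Lambda>1 by (simp add: f_def)
          qed
        qed
      qed
      also have "\<dots> = Q / \<Lambda>1 * (- g x0)" using K by (auto simp: has_bochner_integral_iff)
      also have "\<dots> \<le> Q / \<Lambda>1 * G" using G[of x0] Q \<Lambda>1 by (intro mult_left_mono) auto
      finally show ?thesis .
    qed
    have int: "integrable lborel (\<lambda>z. indicator (cball 0 r) z * F (real j *\<^sub>R h + z))" for j
    proof -
      have "continuous_on (cball 0 r) (\<lambda>z. F (real j *\<^sub>R h + z))"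
        by (intro continuous_on_compose2[OF cF] continuous_intros) auto
      from borel_integrable_compact[OF compact_cball this] show ?thesis by simp
    qed
    \<comment> \<open>The values of \<open>w\<close> along the chain \<open>x0 + z + j h\<close> are
      consecutive increments of \<open>W\<close>, so their sum collapses to a single increment over
      \<open>N\<close> steps.\<close>
    have tel: "real N * w x0 - osc \<le> (\<Sum>j<N. F (real j *\<^sub>R h + z))" for z
    proof -
      have "(\<Sum>j<N. w (x0 + (real j *\<^sub>R h + z)))
        = (\<Sum>j<N. W (x0 + z + real (Suc j) *\<^sub>R h) - W (x0 + z + real j *\<^sub>R h))"
        by (intro sum.cong refl) (simp add: w_def shift_diff_def algebra_simps)
      also have "\<dots> = W (x0 + z + real N *\<^sub>R h) - W (x0 + z)"
        by (subst sum_lessThan_telescope) simp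
      also have "\<dots> \<le> osc" by (rule osc)
      finally show ?thesis by (simp add: F_def sum_subtractf)
    qed
    have vol: "integral\<^sup>L lborel (indicator (cball (0::'a) r)) = \<omega> * r ^ DIM('a)"
      using r content_ball[of 1 "0::'a"] content_cball[of r "0::'a"] by (simp add: \<omega>_def)
    \<comment> \<open>The pointwise telescoping bound is integrated over \<open>z\<close> in the
      ball of radius \<open>r\<close>, which produces the \<open>N\<close> ball integrals already
      estimated.\<close>
    have "(real N * w x0 - osc) * (\<omega> * r ^ DIM('a))
        = (\<integral>z. (real N * w x0 - osc) * indicator (cball 0 r) z \<partial>(lborel :: 'a measure))"
      using vol by simp
    also have "\<dots> \<le> (\<integral>z. (\<Sum>j<N. indicator (cball 0 r) z * F (real j *\<^sub>R h + z)) \<partial>lborel)"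
    proof (rule integral_mono)
      show "integrable lborel (\<lambda>z::'a. (real N * w x0 - osc) * indicator (cball 0 r) z)"
        using emeasure_lborel_cball_finite[of "0::'a" r]
        by (intro integrable_mult_right integrable_real_indicator) (simp_all only: sets_lborel borel_closed closed_cball infinity_ennreal_def)
      show "(real N * w x0 - osc) * indicator (cball 0 r) z \<le> (\<Sum>j<N. indicator (cball 0 r) z * F (real j *\<^sub>R h + z))" for z
        using tel[of z] by (cases "z \<in> cball 0 r") (simp_all add: indicator_def)
    qed (intro Bochner_Integration.integrable_sum int)
    also have "\<dots> = (\<Sum>j<N. \<integral>z. indicator (cball 0 r) z * F (real j *\<^sub>R h + z) \<partial>lborel)"
      by (intro Bochner_Integration.integral_sum int)
    also have "\<dots> \<le> (\<Sum>j<N. Q / \<Lambda>1 * G)" using ball by (intro sum_mono) auto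
    finally have "(real N * w x0 - osc) * (\<omega> * r ^ DIM('a)) \<le> real N * (Q / \<Lambda>1 * G)" by simp
    then have "real N * w x0 - osc \<le> real N * (Q / \<Lambda>1 * G) / (\<omega> * r ^ DIM('a))"
      using mult_pos_pos[OF \<omega> zero_less_power[OF r]] by (simp only: pos_le_divide_eq)
    then have "w x0 \<le> (osc + real N * (Q / \<Lambda>1 * G) / (\<omega> * r ^ DIM('a))) / real N"
      using N by (simp add: pos_le_divide_eq mult.commute)
    also have "\<dots> = osc / N + Q / \<Lambda>1 * G / (\<omega> * r ^ DIM('a))"
      using N by (simp add: add_divide_distrib)
    finally show ?thesis using max[of x] by linarith
  qed
  then show ?thesis unfolding NQ[unfolded \<omega>_def] w_def \<omega>_def .
qed

subsection \<open>Absorption of the top-order seminorm\<close>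

lemma exists_small_powr:
  fixes \<gamma> e :: real
  assumes "0 < \<gamma>" "0 < e"
  obtains \<delta> where "0 < \<delta>" "\<delta> \<le> 1" "\<delta> powr \<gamma> \<le> e"
proof
  show "0 < min 1 (e powr (1 / \<gamma>))" using assms by simp
  show "min 1 (e powr (1 / \<gamma>)) \<le> 1" by simp
  have "min 1 (e powr (1 / \<gamma>)) powr \<gamma> \<le> (e powr (1 / \<gamma>)) powr \<gamma>"
    using assms by (intro powr_mono2) auto
  also have "\<dots> = e" using assms by (simp add: powr_powr)
  finally show "min 1 (e powr (1 / \<gamma>)) powr \<gamma> \<le> e" .
qed

text \<open>The equation is available for difference quotients and not directly for the derivative.
  The mean value theorem puts the quotient at a point within \<open>\<delta> * r\<close>, and the
  growth exponent \<open>\<gamma>\<close> of \<open>\<tau>\<close> converts this into the small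
  factor \<open>\<delta> powr \<gamma>\<close>.\<close>

lemma iter_diff_approx:
  fixes u :: "'a::euclidean_space \<Rightarrow> real" and \<tau> :: "real \<Rightarrow> real"
  assumes pd: "pdiff bs u" "set bs \<subseteq> Basis" and k: "length bs = k"
    and S: "\<And>x h. 0 < norm h \<Longrightarrow> norm h \<le> 1 \<Longrightarrow> \<bar>Dl bs u (x + h) - Dl bs u x\<bar> \<le> S * \<tau> (norm h)" "0 \<le> S"
    and inc: "\<And>r R. 0 < r \<Longrightarrow> r \<le> R \<Longrightarrow> R \<le> 1 \<Longrightarrow> \<tau> r \<le> c * (r / R) powr \<gamma> * \<tau> R" and c: "0 < c" "0 < \<gamma>"
    and \<tau>_pos: "\<And>r. 0 < r \<Longrightarrow> r \<le> 1 \<Longrightarrow> 0 < \<tau> r"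
    and \<delta>: "0 < \<delta>" "\<delta> \<le> 1" and r: "0 < r" "r \<le> 1" and \<rho>: "\<rho> = \<delta> * r / (real k + 1)"
  shows "\<bar>(1 / \<rho>) ^ k * iter_diff \<rho> bs u x - Dl bs u x\<bar> \<le> S * (c * \<delta> powr \<gamma> * \<tau> r)"
proof -
  have \<rho>0: "0 < \<rho>" unfolding \<rho> using \<delta> r by simp
  obtain y where y: "norm (y - x) \<le> real k * \<rho>" "iter_diff \<rho> bs u x = \<rho> ^ k * Dl bs u y"
    using iter_diff_mvt[OF pd \<rho>0] k by auto
  have e: "(1 / \<rho>) ^ k * iter_diff \<rho> bs u x = Dl bs u y"
    unfolding y(2) using \<rho>0 by (simp add: power_one_over)
  \<comment> \<open>Dividing by \<open>k + 1\<close> rather than \<open>k\<close> in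
    \<open>\<rho>\<close> keeps the step positive when \<open>k = 0\<close>.\<close>
  have "real k * \<rho> \<le> (real k + 1) * \<rho>" using \<rho>0 by (intro mult_right_mono) auto
  also have "\<dots> = \<delta> * r" unfolding \<rho> by (simp add: field_simps)
  finally have n: "norm (y - x) \<le> \<delta> * r" using y(1) by linarith
  also have "\<dots> \<le> r" using \<delta> r by (simp add: mult_left_le_one_le)
  finally have nr: "norm (y - x) \<le> r" .
  show ?thesis unfolding e
  proof (cases "y = x")
    case True
    then show "\<bar>Dl bs u y - Dl bs u x\<bar> \<le> S * (c * \<delta> powr \<gamma> * \<tau> r)"
      using S(2) c \<tau>_pos[OF r] by simp
  next
    case False
    then have "\<bar>Dl bs u y - Dl bs u x\<bar> \<le> S * \<tau> (norm (y - x))"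
      using S(1)[of "y - x" x] nr r by simp
    also have "\<tau> (norm (y - x)) \<le> c * (norm (y - x) / r) powr \<gamma> * \<tau> r"
      using False nr r by (intro inc) auto
    also have "(norm (y - x) / r) powr \<gamma> \<le> \<delta> powr \<gamma>"
      using n r c by (intro powr_mono2) (auto simp: field_simps)
    finally show "\<bar>Dl bs u y - Dl bs u x\<bar> \<le> S * (c * \<delta> powr \<gamma> * \<tau> r)"
      using S(2) c \<tau>_pos[OF r] by (simp add: mult_left_mono mult_right_mono)
  qed
qed

text \<open>The previous bound is applied to the quotient \<open>W\<close> of step proportional to
  \<open>norm h\<close>. The two coefficients of \<open>S\<close> are the averaged oscillation,
  small because \<open>\<beta> - 1\<close> will be negative, and the cost of replacing the
  derivative by \<open>W\<close>; the remaining term comes from the right-hand side.\<close>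

lemma shift_diff_Dl_bound:
  fixes u :: "'a::euclidean_space \<Rightarrow> real" and \<tau> :: "real \<Rightarrow> real"
  assumes sol: "solves a0 \<phi> u f" and pd: "pdiff bs u" "set bs \<subseteq> Basis" and k: "length bs = k"
    and \<phi>_pos: "\<And>r. 0 < r \<Longrightarrow> 0 < \<phi> r"
    and \<phi>_mono: "\<And>lam r. 1 \<le> lam \<Longrightarrow> 0 < r \<Longrightarrow> a1 * \<phi> r \<le> \<phi> (lam * r)" and a1: "0 < a1"
    and \<phi>_B: "\<And>r. 0 < r \<Longrightarrow> \<phi> ((real N + 1) * r) \<le> B * \<phi> r"
    and a0: "\<And>h. h \<noteq> 0 \<Longrightarrow> \<Lambda>1 \<le> a0 h" and \<Lambda>1: "0 < \<Lambda>1"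
    and \<tau>: "\<And>r. 0 < r \<Longrightarrow> \<tau> r = \<phi> r * \<psi> r / r ^ k" and \<tau>_pos: "\<And>r. 0 < r \<Longrightarrow> r \<le> 1 \<Longrightarrow> 0 < \<tau> r"
    and F: "\<And>x h. 0 < norm h \<Longrightarrow> norm h \<le> 1 \<Longrightarrow> \<bar>f (x + h) - f x\<bar> \<le> F * \<psi> (norm h)"
    and S: "\<And>x h. 0 < norm h \<Longrightarrow> norm h \<le> 1 \<Longrightarrow> \<bar>Dl bs u (x + h) - Dl bs u x\<bar> \<le> S * \<tau> (norm h)" "0 \<le> S"
    and inc: "\<And>r R. 0 < r \<Longrightarrow> r \<le> R \<Longrightarrow> R \<le> 1 \<Longrightarrow> \<tau> r \<le> c * (r / R) powr \<gamma> * \<tau> R" and c: "0 < c" "0 < \<gamma>"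
    and dec: "\<And>r R. 0 < r \<Longrightarrow> r \<le> R \<Longrightarrow> R \<le> 1 \<Longrightarrow> \<tau> R \<le> C * (R / r) powr \<beta> * \<tau> r"
    and N: "0 < N" and \<delta>: "0 < \<delta>" "\<delta> \<le> 1" and h: "0 < norm h" "real N * norm h \<le> 1"
  shows "\<bar>Dl bs u (x + h) - Dl bs u x\<bar> \<le> \<tau> (norm h) *
    (S * (C * real N powr (\<beta> - 1) + 4 * c * \<delta> powr \<gamma>) +
     (real N + 1) ^ DIM('a) * B / (a1 * \<Lambda>1 * measure lborel (ball (0::'a) 1)) * (2 * (real k + 1) / \<delta>) ^ k * F)"
proof -
  define r where "r = norm h"
  define \<rho> where "\<rho> = \<delta> * r / (real k + 1)"
  define e where "e = S * (c * \<delta> powr \<gamma> * \<tau> r)"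
  define A where "A = a1 * \<Lambda>1 * measure lborel (ball (0::'a) 1)"
  \<comment> \<open>The increment of \<open>f\<close> over \<open>h\<close> is at most
    \<open>F * \<psi> r\<close>; each of the \<open>k\<close> further differences at most doubles
    it, and the normalisation divides by \<open>\<rho>\<close> each time.\<close>
  define G where "G = (2 / \<rho>) ^ k * (F * \<psi> r)"
  \<comment> \<open>The derivative oscillates by the first term at distance \<open>N * r\<close>;
    replacing it by \<open>W\<close> costs \<open>e\<close> at each of the two endpoints.\<close>
  define osc where "osc = S * \<tau> (real N * r) + 2 * e"
  define W where "W y = (1 / \<rho>) ^ k * iter_diff \<rho> bs u y" for y
  have "norm h \<le> real N * norm h" using N by (simp add: mult_le_cancel_right1)
  also have "\<dots> \<le> 1" by (rule h)
  finally have r: "0 < r" "r \<le> 1" "real N * r \<le> 1" using h by (auto simp: r_def)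
  have \<rho>0: "0 < \<rho>" unfolding \<rho>_def using \<delta> r by simp
  have A: "0 < A" unfolding A_def using a1 \<Lambda>1 by simp
  have e0: "0 \<le> e" unfolding e_def using S(2) c \<tau>_pos r by (simp add: less_imp_le)
  have approx: "\<bar>W y - Dl bs u y\<bar> \<le> e" for y
    unfolding W_def e_def
    by (rule iter_diff_approx[where \<gamma>=\<gamma>, OF pd k S inc c \<tau>_pos \<delta> r(1,2) \<rho>_def])
  \<comment> \<open>The sign \<open>s\<close> applies the one-sided maximum principle to both
    \<open>W\<close> and \<open>- W\<close>, which yields the absolute value.\<close>
  have step: "s * shift_diff h W x \<le> osc / N + (real N + 1) ^ DIM('a) * \<phi> ((real N + 1) * r) / A * G"
    if s: "\<bar>s\<bar> = 1" for s x
  proof -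
    have solW: "solves a0 \<phi> (\<lambda>y. s * W y) (\<lambda>y. s * ((1 / \<rho>) ^ k * iter_diff \<rho> bs f y))"
      unfolding W_def by (intro solves_scale solves_iter_diff sol)
    have "shift_diff h (\<lambda>y. s * W y) x \<le> osc / N +
      (real N + 1) ^ DIM('a) * \<phi> ((real N + 1) * norm h) / (a1 * \<Lambda>1 * measure lborel (ball (0::'a) 1)) * G"
    proof (rule shift_diff_le_oscillation[where \<phi>=\<phi> and ?a0.0=a0 and G=G, OF solves_shift_diff[OF solW] _ \<phi>_pos \<phi>_mono a1 a0 \<Lambda>1 _ N])
      show "continuous_on UNIV (\<lambda>y. s * W y)"
        using solW by (simp add: solves_def vanishes_at_infinity_def)
      show "h \<noteq> 0" using h by auto
      fix x
      have "shift_diff h (\<lambda>y. s * ((1 / \<rho>) ^ k * iter_diff \<rho> bs f y)) x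
          = s * ((1 / \<rho>) ^ k * iter_diff \<rho> bs (shift_diff h f) x)"
        unfolding iter_diff_shift_diff by (simp add: shift_diff_def algebra_simps)
      moreover have "\<bar>iter_diff \<rho> bs (shift_diff h f) x\<bar> \<le> 2 ^ k * (F * \<psi> r)"
        unfolding k[symmetric] by (rule iter_diff_bound) (use F h r in \<open>auto simp: shift_diff_def r_def\<close>)
      then have "(1 / \<rho>) ^ k * \<bar>iter_diff \<rho> bs (shift_diff h f) x\<bar> \<le> (1 / \<rho>) ^ k * (2 ^ k * (F * \<psi> r))"
        using \<rho>0 by (intro mult_left_mono) auto
      ultimately show "\<bar>shift_diff h (\<lambda>y. s * ((1 / \<rho>) ^ k * iter_diff \<rho> bs f y)) x\<bar> \<le> G"
        using s \<rho>0 by (simp add: abs_mult G_def power_divide)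
      have "\<bar>Dl bs u (x + real N *\<^sub>R h) - Dl bs u x\<bar> \<le> S * \<tau> (real N * r)"
        using S(1)[of "real N *\<^sub>R h" x] h N r by (simp add: r_def)
      then have "\<bar>W (x + real N *\<^sub>R h) - W x\<bar> \<le> osc"
        using approx[of x] approx[of "x + real N *\<^sub>R h"] unfolding osc_def by linarith
      moreover have "s = 1 \<or> s = -1" using s by linarith
      ultimately show "s * W (x + real N *\<^sub>R h) - s * W x \<le> osc" by auto
    next
      show "0 \<le> osc" unfolding osc_def using S(2) e0 \<tau>_pos[of "real N * r"] r N by simp
    qed
    then show ?thesis by (simp add: shift_diff_def algebra_simps A_def r_def)
  qed
  \<comment> \<open>Since \<open>\<rho>\<close> is proportional to \<open>r\<close>, the factor
    \<open>r ^ k\<close> lost in the quotient is exactly the one in the denominator of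
    \<open>\<tau>\<close>.\<close>
  have G: "\<phi> r * G = (2 * (real k + 1) / \<delta>) ^ k * F * \<tau> r"
    unfolding G_def \<rho>_def \<tau>[OF r(1)] using r \<delta> by (simp add: power_divide power_mult_distrib)
  have G0: "0 \<le> G"
  proof -
    have "0 \<le> F * \<psi> r" using F[of h 0] h r by (simp add: r_def)
    then show ?thesis unfolding G_def using \<rho>0 by simp
  qed
  have "(real N + 1) ^ DIM('a) * \<phi> ((real N + 1) * r) / A * G \<le> (real N + 1) ^ DIM('a) * (B * \<phi> r) / A * G"
    using \<phi>_B[OF r(1)] A G0 by (intro mult_right_mono divide_right_mono mult_left_mono) auto
  also have "\<dots> = (real N + 1) ^ DIM('a) * B / A * (\<phi> r * G)" by simp
  also have "\<dots> = \<tau> r * ((real N + 1) ^ DIM('a) * B / A * (2 * (real k + 1) / \<delta>) ^ k * F)"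
    unfolding G by simp
  finally have t2: "(real N + 1) ^ DIM('a) * \<phi> ((real N + 1) * r) / A * G
     \<le> \<tau> r * ((real N + 1) ^ DIM('a) * B / A * (2 * (real k + 1) / \<delta>) ^ k * F)" .
  have "\<tau> (real N * r) \<le> C * (real N * r / r) powr \<beta> * \<tau> r"
    using r N by (intro dec) (auto simp: mult_le_cancel_right1)
  then have "\<tau> (real N * r) \<le> C * real N powr \<beta> * \<tau> r" using r by simp
  then have "S * \<tau> (real N * r) / N \<le> S * (C * real N powr \<beta> * \<tau> r) / N"
    using S(2) by (intro divide_right_mono mult_left_mono) auto
  also have "\<dots> = \<tau> r * (S * (C * real N powr (\<beta> - 1)))"
    using N by (simp add: powr_diff)
  finally have t1: "S * \<tau> (real N * r) / N \<le> \<tau> r * (S * (C * real N powr (\<beta> - 1)))" .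
  have "2 * e / N \<le> 2 * e / 1" using N e0 by (intro divide_left_mono) auto
  with t1 have "osc / N \<le> \<tau> r * (S * (C * real N powr (\<beta> - 1))) + 2 * e"
    unfolding osc_def by (simp add: add_divide_distrib)
  with step[of 1 x] step[of "-1" x] t2
  have "\<bar>shift_diff h W x\<bar> \<le> \<tau> r * (S * (C * real N powr (\<beta> - 1))) + 2 * e
    + \<tau> r * ((real N + 1) ^ DIM('a) * B / A * (2 * (real k + 1) / \<delta>) ^ k * F)" by simp
  \<comment> \<open>Returning from \<open>W\<close> to the derivative costs \<open>e\<close> at
    \<open>x\<close> and at \<open>x + h\<close>; with the \<open>2 * e\<close> inside
    \<open>osc\<close> this makes \<open>4 * e\<close>.\<close>
  then have "\<bar>Dl bs u (x + h) - Dl bs u x\<bar> \<le> \<tau> r * (S * (C * real N powr (\<beta> - 1))) + 4 * e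
    + \<tau> r * ((real N + 1) ^ DIM('a) * B / A * (2 * (real k + 1) / \<delta>) ^ k * F)"
    using approx[of x] approx[of "x + h"] by (simp add: shift_diff_def)
  then show ?thesis unfolding e_def A_def r_def by (simp add: algebra_simps)
qed

text \<open>Dividing by \<open>r ^ k\<close> moves the indices into the open unit interval, whence
  \<open>\<gamma> > 0\<close> and \<open>\<beta> < 1\<close>. \<open>K\<close> is chosen before
  \<open>u\<close>, \<open>f\<close> and \<open>bs\<close>; boundedness of the quotients makes the
  seminorm a genuine finite bound, so half of it can be absorbed.\<close>

lemma hseminorm_schauder:
  fixes a0 :: "'a::euclidean_space \<Rightarrow> real" and \<phi> \<psi> :: "real \<Rightarrow> real" and k :: nat
  defines "\<tau> \<equiv> \<lambda>r. \<phi> r * \<psi> r * r powr (- real k)"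
  assumes \<phi>_pos: "\<And>r. 0 < r \<Longrightarrow> 0 < \<phi> r"
    and \<phi>_mono: "\<And>lam r. 1 \<le> lam \<Longrightarrow> 0 < r \<Longrightarrow> a1 * \<phi> r \<le> \<phi> (lam * r)" and a1: "0 < a1"
    and \<phi>_B: "\<And>lam. 1 \<le> lam \<Longrightarrow> \<exists>B>0. \<forall>r>0. \<phi> (lam * r) \<le> B * \<phi> r"
    and \<psi>_pos: "\<And>r. 0 < r \<Longrightarrow> r \<le> 1 \<Longrightarrow> 0 < \<psi> r" and one: "\<phi> 1 = 1" "\<psi> 1 = 1"
    and a0: "\<And>h. h \<noteq> 0 \<Longrightarrow> \<Lambda>1 \<le> a0 h" and \<Lambda>1: "0 < \<Lambda>1"
    and inc: "\<And>r R. 0 < r \<Longrightarrow> r \<le> R \<Longrightarrow> R \<le> 1 \<Longrightarrow> \<tau> r \<le> c * (r / R) powr \<gamma> * \<tau> R" and c: "0 < c" "0 < \<gamma>"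
    and dec: "\<And>r R. 0 < r \<Longrightarrow> r \<le> R \<Longrightarrow> R \<le> 1 \<Longrightarrow> \<tau> R \<le> C * (R / r) powr \<beta> * \<tau> r" and C: "0 < C" "\<beta> < 1"
  shows "\<exists>K\<ge>0. \<forall>u f bs F U. solves a0 \<phi> u f \<longrightarrow> pdiff bs u \<longrightarrow> set bs \<subseteq> Basis \<longrightarrow> length bs = k \<longrightarrow>
    (\<forall>x. \<bar>u x\<bar> \<le> U) \<longrightarrow> 0 \<le> F \<longrightarrow>
    (\<forall>x h. 0 < norm h \<longrightarrow> norm h \<le> 1 \<longrightarrow> \<bar>f (x + h) - f x\<bar> \<le> F * \<psi> (norm h)) \<longrightarrow>
    bdd_above (hq_set (\<lambda>r. \<phi> r * \<psi> r) k (Dl bs u)) \<longrightarrow>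
    hseminorm (\<lambda>r. \<phi> r * \<psi> r) k (Dl bs u) \<le> K * (U + F) \<and> (\<forall>x. \<bar>Dl bs u x\<bar> \<le> K * (U + F))"
proof -
  have \<tau>: "\<tau> r = \<phi> r * \<psi> r / r ^ k" if "0 < r" for r
    using that by (simp add: \<tau>_def powr_minus_divide powr_realpow)
  have \<tau>_pos: "0 < \<tau> r" if "0 < r" "r \<le> 1" for r
    unfolding \<tau>_def using \<phi>_pos \<psi>_pos that by simp
  have \<tau>1: "\<tau> 1 = 1" using one by (simp add: \<tau>_def)
  \<comment> \<open>\<open>\<delta>\<close> makes \<open>4 * c * \<delta> powr \<gamma>\<close> at
    most 1/4; then \<open>t\<close> and \<open>N > 1 / t\<close> do the same for
    \<open>C * N powr (\<beta> - 1)\<close>. Together they leave the coefficient 1/2 for the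
    seminorm.\<close>
  obtain \<delta> where \<delta>: "0 < \<delta>" "\<delta> \<le> 1" "\<delta> powr \<gamma> \<le> 1 / (16 * c)"
    using exists_small_powr[of \<gamma> "1 / (16 * c)"] c by auto
  obtain t where t: "0 < t" "t \<le> 1" "t powr (1 - \<beta>) \<le> 1 / (4 * C)"
    using exists_small_powr[of "1 - \<beta>" "1 / (4 * C)"] C by auto
  obtain N :: nat where N: "1 / t < real N" using reals_Archimedean2 by blast
  then have N0: "0 < N" using t by (cases N) (auto simp: field_simps)
  have "real N powr (\<beta> - 1) = (1 / real N) powr (1 - \<beta>)"
    using N0 powr_minus[of "real N" "1 - \<beta>"] by (simp add: powr_divide inverse_eq_divide)
  also have "\<dots> \<le> t powr (1 - \<beta>)" using N N0 t C by (intro powr_mono2) (auto simp: field_simps)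
  finally have "real N powr (\<beta> - 1) \<le> 1 / (4 * C)" using t(3) by linarith
  then have small1: "C * real N powr (\<beta> - 1) + 4 * c * \<delta> powr \<gamma> \<le> 1 / 2"
    using \<delta>(3) c C by (simp add: field_simps)
  obtain B where B: "0 < B" "\<And>r. 0 < r \<Longrightarrow> \<phi> ((real N + 1) * r) \<le> B * \<phi> r"
    using \<phi>_B[of "real N + 1"] by auto
  \<comment> \<open>A second small parameter, chosen after \<open>N\<close>, serves increments that
    are too long for the equation: it makes \<open>2 * C * N * c * \<eta> powr \<gamma>\<close> at
    most 1/2.\<close>
  obtain \<eta> where \<eta>: "0 < \<eta>" "\<eta> \<le> 1" "\<eta> powr \<gamma> \<le> 1 / (4 * C * N * c)"
    using exists_small_powr[of \<gamma> "1 / (4 * C * N * c)"] c C N0 by auto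
  define A where "A = (real N + 1) ^ DIM('a) * B / (a1 * \<Lambda>1 * measure lborel (ball (0::'a) 1)) * (2 * (real k + 1) / \<delta>) ^ k"
  define E where "E = (2 * (real k + 1) / \<eta>) ^ k"
  define M where "M = A + 2 * C * N * E"
  have A0: "0 \<le> A" unfolding A_def using B a1 \<Lambda>1 \<delta> by (intro mult_nonneg_nonneg divide_nonneg_nonneg) auto
  have E0: "0 \<le> E" unfolding E_def using \<eta> by simp
  have M0: "0 \<le> M" "A \<le> M" "2 * C * N * E \<le> M" unfolding M_def using A0 E0 C by simp_all
  \<comment> \<open>\<open>2 * M\<close> is what absorption gives for the seminorm, and
    \<open>E + 2 * M * c\<close> what interpolation then gives for the supremum of the
    derivative.\<close>
  define K where "K = 2 * M + E + 2 * M * c"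
  have K0: "0 \<le> K" "2 * M \<le> K" "E + c * (2 * M) \<le> K" unfolding K_def using M0 E0 c by (simp_all add: mult.commute)
  show ?thesis
  proof (intro exI[of _ K] conjI allI impI K0(1))
    fix u f :: "'a \<Rightarrow> real" and bs :: "'a list" and F U :: real
    assume sol: "solves a0 \<phi> u f" and pd: "pdiff bs u" "set bs \<subseteq> Basis" and k: "length bs = k"
      and U: "\<forall>x. \<bar>u x\<bar> \<le> U" and F0: "0 \<le> F"
      and F: "\<forall>x h. 0 < norm h \<longrightarrow> norm h \<le> 1 \<longrightarrow> \<bar>f (x + h) - f x\<bar> \<le> F * \<psi> (norm h)"
      and bdd: "bdd_above (hq_set (\<lambda>r. \<phi> r * \<psi> r) k (Dl bs u))"
    define v where "v = Dl bs u"
    define S where "S = hseminorm (\<lambda>r. \<phi> r * \<psi> r) k v"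
    have U0: "0 \<le> U" using U abs_ge_zero[of "u 0"] order_trans by blast
    have hq: "hq_set (\<lambda>r. \<phi> r * \<psi> r) k v = {\<bar>v (x + h) - v x\<bar> / \<tau> (norm h) | x h. 0 < norm h \<and> norm h \<le> 1}"
      by (simp add: hq_set_def \<tau>_def)
    \<comment> \<open>\<open>bdd\<close> enters here: for an unbounded set of reals
      \<open>Sup\<close> would not bound the quotients.\<close>
    have Sq: "\<bar>v (x + h) - v x\<bar> / \<tau> (norm h) \<le> S" if "0 < norm h" "norm h \<le> 1" for x h
      unfolding S_def hseminorm_def
      by (rule cSup_upper[OF _ bdd[folded v_def]]) (use that in \<open>unfold hq, blast\<close>)
    then have S: "\<bar>v (x + h) - v x\<bar> \<le> S * \<tau> (norm h)" if "0 < norm h" "norm h \<le> 1" for x h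
      using Sq[OF that, of x] \<tau>_pos[OF that] by (simp add: pos_divide_le_eq)
    obtain b :: 'a where b: "b \<in> Basis" using nonempty_Basis by blast
    have S0: "0 \<le> S"
      using Sq[of b 0] b \<tau>1 by (simp add: order_trans[OF abs_ge_zero])
    \<comment> \<open>Interpolation at unit scale: a difference quotient of fixed step is bounded by
      \<open>E * U\<close>, and it differs from the derivative by a small multiple of the
      seminorm.\<close>
    have v_bound: "\<bar>v x\<bar> \<le> E * U + S * (c * \<eta> powr \<gamma>)" for x
    proof -
      define \<rho> where "\<rho> = \<eta> * 1 / (real k + 1)"
      have \<rho>0: "0 < \<rho>" unfolding \<rho>_def using \<eta> by simp
      have "\<bar>(1 / \<rho>) ^ k * iter_diff \<rho> bs u x - v x\<bar> \<le> S * (c * \<eta> powr \<gamma> * \<tau> 1)"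
        unfolding v_def
        by (rule iter_diff_approx[where \<gamma>=\<gamma>, OF pd k _ S0 inc c \<tau>_pos \<eta>(1,2) _ _ \<rho>_def])
           (use S in \<open>auto simp: v_def\<close>)
      moreover have "\<bar>(1 / \<rho>) ^ k * iter_diff \<rho> bs u x\<bar> \<le> (1 / \<rho>) ^ k * (2 ^ k * U)"
        unfolding abs_mult using iter_diff_bound[of u U \<rho> bs x] U k \<rho>0 by (simp add: mult_left_mono)
      moreover have "1 / \<rho> * 2 = 2 * (real k + 1) / \<eta>" unfolding \<rho>_def by simp
      then have "(1 / \<rho>) ^ k * 2 ^ k = E" unfolding E_def by (metis power_mult_distrib)
      then have "(1 / \<rho>) ^ k * (2 ^ k * U) = E * U" by (simp add: mult.assoc[symmetric])
      ultimately show ?thesis unfolding \<tau>1 by linarith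
    qed
    have "S \<le> S / 2 + M * (U + F)"
    proof -
      have "\<bar>v (x + h) - v x\<bar> / \<tau> (norm h) \<le> S / 2 + M * (U + F)"
        if h: "0 < norm h" "norm h \<le> 1" for x h
      \<comment> \<open>Short increments, for which all \<open>N\<close> translates stay within
        distance 1, are handled by the equation; long ones by the supremum bound, because there
        \<open>\<tau>\<close> is bounded below.\<close>
      proof (cases "real N * norm h \<le> 1")
        case True
        have "\<bar>v (x + h) - v x\<bar> \<le> \<tau> (norm h) * (S * (C * real N powr (\<beta> - 1) + 4 * c * \<delta> powr \<gamma>) + A * F)"
          unfolding v_def A_def
          by (rule shift_diff_Dl_bound[where \<gamma>=\<gamma>, OF sol pd k \<phi>_pos \<phi>_mono a1 B(2) a0 \<Lambda>1 \<tau> \<tau>_pos _ _ S0 inc c dec N0 \<delta>(1,2) h(1) True])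
             (use F S in \<open>auto simp: v_def\<close>)
        then have "\<bar>v (x + h) - v x\<bar> / \<tau> (norm h) \<le> S * (C * real N powr (\<beta> - 1) + 4 * c * \<delta> powr \<gamma>) + A * F"
          using \<tau>_pos[OF h] by (simp add: pos_divide_le_eq mult.commute)
        also have "\<dots> \<le> S * (1 / 2) + M * (U + F)"
          using small1 S0 M0 U0 F0 by (intro add_mono mult_left_mono mult_mono) auto
        finally show ?thesis by simp
      next
        case False
        then have n: "1 / norm h \<le> real N" using h by (simp add: field_simps)
        \<comment> \<open>The normalisation at 1 and the decay exponent compare
          \<open>norm h\<close> with 1. As \<open>1 / norm h \<ge> 1\<close> and
          \<open>\<beta> < 1\<close>, the exponent may be raised to 1, and \<open>1 / norm h\<close>
          is below \<open>N\<close>.\<close>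
        have "1 = \<tau> 1" by (simp add: \<tau>1)
        also have "\<dots> \<le> C * (1 / norm h) powr \<beta> * \<tau> (norm h)" using h by (intro dec) auto
        also have "\<dots> \<le> C * (1 / norm h) powr 1 * \<tau> (norm h)"
          using h C \<tau>_pos[OF h] by (intro mult_right_mono mult_left_mono powr_mono) auto
        also have "\<dots> \<le> C * N * \<tau> (norm h)"
          using h C n \<tau>_pos[OF h] by (intro mult_right_mono mult_left_mono) auto
        finally have t1: "1 / \<tau> (norm h) \<le> C * N" using \<tau>_pos[OF h] by (simp add: field_simps)
        have "\<bar>v (x + h) - v x\<bar> \<le> 2 * (E * U + S * (c * \<eta> powr \<gamma>))"
          unfolding mult_2 by (rule order_trans[OF abs_triangle_ineq4 add_mono[OF v_bound v_bound]])
        then have "\<bar>v (x + h) - v x\<bar> * (1 / \<tau> (norm h)) \<le> 2 * (E * U + S * (c * \<eta> powr \<gamma>)) * (C * N)"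
          using t1 \<tau>_pos[OF h] by (intro mult_mono) auto
        also have "\<dots> = 2 * C * N * E * U + S * (2 * C * N * c * \<eta> powr \<gamma>)" by (simp add: algebra_simps)
        also have "\<dots> \<le> M * (U + F) + S * (1 / 2)"
        proof (intro add_mono mult_left_mono mult_mono S0)
          have "2 * C * N * c * \<eta> powr \<gamma> \<le> 2 * C * N * c * (1 / (4 * C * N * c))"
            using \<eta>(3) C c by (intro mult_left_mono) auto
          then show "2 * C * N * c * \<eta> powr \<gamma> \<le> 1 / 2" using C c N0 by simp
        qed (use M0 U0 F0 in auto)
        finally show ?thesis by simp
      qed
      moreover have "hq_set (\<lambda>r. \<phi> r * \<psi> r) k v \<noteq> {}"
        unfolding hq using b by (auto intro!: exI[of _ b])
      ultimately have "Sup (hq_set (\<lambda>r. \<phi> r * \<psi> r) k v) \<le> S / 2 + M * (U + F)"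
        by (intro cSup_least) (auto simp: hq)
      then show ?thesis by (simp add: S_def hseminorm_def)
    qed
    then have S2: "S \<le> 2 * M * (U + F)" by simp
    also have "\<dots> \<le> K * (U + F)" using K0 U0 F0 by (intro mult_right_mono) auto
    finally show "hseminorm (\<lambda>r. \<phi> r * \<psi> r) k (Dl bs u) \<le> K * (U + F)" by (simp add: S_def v_def)
    fix x
    have "\<eta> powr \<gamma> \<le> 1" using \<eta> c by (intro powr_le1) auto
    then have "S * (c * \<eta> powr \<gamma>) \<le> (2 * M * (U + F)) * (c * 1)"
      using S2 S0 c U0 F0 M0 by (intro mult_mono) auto
    then have "\<bar>v x\<bar> \<le> E * (U + F) + (2 * M * (U + F)) * c"
      using v_bound[of x] mult_left_mono[OF _ E0, of U "U + F"] F0 by auto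
    also have "\<dots> = (E + c * (2 * M)) * (U + F)" by (simp add: algebra_simps)
    also have "\<dots> \<le> K * (U + F)" using K0 U0 F0 by (intro mult_right_mono) auto
    finally show "\<bar>Dl bs u x\<bar> \<le> K * (U + F)" by (simp add: v_def)
  qed
qed

subsection \<open>Indices and norms\<close>

lemma less_lower_indexE:
  assumes "ereal a < lower_index g"
  obtains \<alpha> c where "a < \<alpha>" "0 < c"
    "\<And>r R. 0 < r \<Longrightarrow> r \<le> R \<Longrightarrow> R \<le> 1 \<Longrightarrow> c * (g r / r powr \<alpha>) \<le> g R / R powr \<alpha>"
proof -
  obtain \<alpha> where "almost_increasing (\<lambda>r. g r / r powr \<alpha>)" "a < \<alpha>"
    using assms unfolding lower_index_def less_Sup_iff by auto
  with that show thesis unfolding almost_increasing_def by blast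
qed

lemma upper_index_lessE:
  assumes "upper_index g < ereal a"
  obtains \<alpha> C where "\<alpha> < a" "1 \<le> C"
    "\<And>r R. 0 < r \<Longrightarrow> r \<le> R \<Longrightarrow> R \<le> 1 \<Longrightarrow> g R / R powr \<alpha> \<le> C * (g r / r powr \<alpha>)"
proof -
  obtain \<alpha> where "almost_decreasing (\<lambda>r. g r / r powr \<alpha>)" "\<alpha> < a"
    using assms unfolding upper_index_def Inf_less_iff by auto
  with that show thesis unfolding almost_decreasing_def by blast
qed

text \<open>Otherwise exponents \<open>\<beta> < \<alpha>\<close> exist for which \<open>g\<close>
  is at most a multiple of \<open>r powr \<alpha>\<close> and at least a multiple of
  \<open>r powr \<beta>\<close>, impossible for small \<open>r\<close>. Consequently the index
  interval contains its endpoints, so inclusions of it carry information.\<close>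

lemma lower_index_le_upper_index:
  assumes pos: "\<And>r. 0 < r \<Longrightarrow> r \<le> 1 \<Longrightarrow> 0 < g r"
  shows "lower_index g \<le> upper_index g"
proof (rule ccontr)
  assume "\<not> ?thesis"
  then obtain a where "upper_index g < ereal a" "ereal a < lower_index g"
    using ereal_dense2 not_le by metis
  then obtain \<alpha> c \<beta> C where \<alpha>: "a < \<alpha>" "0 < c" "\<And>r R. 0 < r \<Longrightarrow> r \<le> R \<Longrightarrow> R \<le> 1 \<Longrightarrow> c * (g r / r powr \<alpha>) \<le> g R / R powr \<alpha>"
    and \<beta>: "\<beta> < a" "1 \<le> C" "\<And>r R. 0 < r \<Longrightarrow> r \<le> R \<Longrightarrow> R \<le> 1 \<Longrightarrow> g R / R powr \<beta> \<le> C * (g r / r powr \<beta>)"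
    by (metis less_lower_indexE upper_index_lessE)
  obtain r where r: "0 < r" "r \<le> 1" "r powr (\<alpha> - \<beta>) \<le> c / (2 * C)"
    using exists_small_powr[of "\<alpha> - \<beta>" "c / (2 * C)"] \<alpha> \<beta> by auto
  have "c * g r \<le> g 1 * r powr \<alpha>" using \<alpha>(3)[of r 1] r by (simp add: field_simps)
  also have "g 1 \<le> C * (g r / r powr \<beta>)" using \<beta>(3)[of r 1] r by simp
  finally have "c * g r \<le> C * (g r / r powr \<beta>) * r powr \<alpha>" using r by (simp add: mult_right_mono)
  also have "\<dots> = C * r powr (\<alpha> - \<beta>) * g r" by (simp add: powr_diff)
  finally have "c \<le> C * r powr (\<alpha> - \<beta>)" using pos[OF r(1,2)] by simp
  also have "\<dots> \<le> C * (c / (2 * C))" using r \<beta> by (intro mult_left_mono) auto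
  finally show False using \<alpha> \<beta> by simp
qed

lemma horder_eq:
  assumes "ereal (real k) < lower_index g" "lower_index g \<le> ereal (real k + 1)"
  shows "horder g = k"
  unfolding horder_def
proof (rule the_equality)
  fix j :: nat
  assume j: "ereal (real j) < lower_index g \<and> lower_index g \<le> ereal (real j + 1)"
  then have "ereal (real j) < ereal (real k + 1)" "ereal (real k) < ereal (real j + 1)"
    using assms by (metis order.strict_trans2)+
  then show "j = k" by simp
qed (use assms in auto)

lemma finite_multi_idx: "finite (multi_idx j :: 'a::euclidean_space list set)"
  unfolding multi_idx_def by (rule finite_lists_length_eq) simp

lemma multi_idx_nonempty: "multi_idx j \<noteq> ({} :: 'a::euclidean_space list set)"
proof -
  obtain b :: 'a where "b \<in> Basis" using nonempty_Basis by blast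
  then have "replicate j b \<in> multi_idx j" by (auto simp: multi_idx_def)
  then show ?thesis by blast
qed

lemma Max_multi_idx_le:
  assumes "\<And>bs :: 'a::euclidean_space list. bs \<in> multi_idx j \<Longrightarrow> F bs \<le> (B :: real)"
  shows "Max (F ` multi_idx j) \<le> B"
  using assms by (subst Max_le_iff) (auto simp: finite_multi_idx multi_idx_nonempty)

text \<open>The norm has one supremum term for each order from 0 to \<open>horder g\<close> and one
  seminorm, hence the factor \<open>horder g + 2\<close>.\<close>

lemma hnorm_le:
  assumes "\<And>bs x. set bs \<subseteq> Basis \<Longrightarrow> length bs \<le> horder g \<Longrightarrow> \<bar>Dl bs u x\<bar> \<le> B"
    and "\<And>bs. set bs \<subseteq> Basis \<Longrightarrow> length bs = horder g \<Longrightarrow> hseminorm g (horder g) (Dl bs u) \<le> B"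
  shows "hnorm g u \<le> (real (horder g) + 2) * B"
proof -
  have "(\<Sum>j\<le>horder g. Max ((\<lambda>bs. sup_norm (Dl bs u)) ` multi_idx j)) \<le> (\<Sum>j\<le>horder g. B)"
    by (intro sum_mono Max_multi_idx_le) (auto simp: multi_idx_def sup_norm_def intro!: cSUP_least assms(1))
  moreover have "Max ((\<lambda>bs. hseminorm g (horder g) (Dl bs u)) ` multi_idx (horder g)) \<le> B"
    by (intro Max_multi_idx_le) (auto simp: multi_idx_def intro!: assms(2))
  ultimately show ?thesis unfolding hnorm_def by (simp add: algebra_simps)
qed

lemma hoelder_space_pdiff:
  assumes "u \<in> hoelder_space g" "set bs \<subseteq> Basis" "length bs \<le> horder g"
  shows "pdiff bs u"
  using assms(2,3)
proof (induction bs)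
  case (Cons b bs)
  then have "b # bs \<in> multi_idx (length (b # bs))" by (auto simp: multi_idx_def)
  then have "\<forall>x. has_pderiv b (Dl bs u) x"
    using assms(1) Cons.prems(2) unfolding hoelder_space_def by fastforce
  with Cons show ?case by auto
qed simp

lemma hoelder_space_bdd_hq_set:
  assumes "u \<in> hoelder_space g" "set bs \<subseteq> Basis" "length bs = horder g"
  shows "bdd_above (hq_set g (horder g) (Dl bs u))"
  using assms unfolding hoelder_space_def multi_idx_def by auto

lemma abs_le_sup_norm:
  assumes "u \<in> hoelder_space g"
  shows "\<bar>u x\<bar> \<le> sup_norm u"
proof -
  have "[] \<in> multi_idx 0" by (simp add: multi_idx_def)
  then have "bounded_cont (Dl [] u)" using assms unfolding hoelder_space_def by blast
  then have "bounded (range u)" by (simp add: bounded_cont_def)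
  then obtain B where "\<And>y. \<bar>u y\<bar> \<le> B" by (auto simp: bounded_iff)
  then show ?thesis unfolding sup_norm_def by (intro cSUP_upper) (auto simp: bdd_above_def)
qed

lemma hnorm_horder_0:
  assumes "horder g = 0"
  shows "hnorm g f = sup_norm f + hseminorm g 0 f"
  using assms by (simp add: hnorm_def multi_idx_def cong: conj_cong)

lemma hseminorm_0_bound:
  assumes "f \<in> hoelder_space g" "horder g = 0" and pos: "\<And>r. 0 < r \<Longrightarrow> r \<le> 1 \<Longrightarrow> 0 < g r"
    and h: "0 < norm h" "norm h \<le> 1"
  shows "\<bar>f (x + h) - f x\<bar> \<le> hseminorm g 0 f * g (norm h)"
proof -
  have "bdd_above (hq_set g 0 f)" using hoelder_space_bdd_hq_set[OF assms(1), of "[]"] assms(2) by simp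
  then have "\<bar>f (x + h) - f x\<bar> / (g (norm h) * norm h powr (- real 0)) \<le> hseminorm g 0 f"
    unfolding hseminorm_def by (intro cSup_upper) (use h in \<open>auto simp: hq_set_def\<close>)
  then show ?thesis using h pos[OF h] by (simp add: pos_divide_le_eq)
qed

section \<open>From the top-order estimate to the full norm\<close>

theorem theorem1p1:
  fixes \<phi> \<psi> :: "real \<Rightarrow> real" and a0 :: "'a::euclidean_space \<Rightarrow> real" and \<Lambda>1 \<Lambda>2 :: real
  assumes "admissible_modulus \<psi>"
    and "admissible_order \<phi>"
    and "index_interval \<psi> \<subseteq> {0<..<1}"
    and "index_interval (\<lambda>r. \<phi> r * \<psi> r) \<subseteq> {0<..<1} \<union> {1<..<2} \<union> {2<..<3}"
    and "0 < \<Lambda>1" and "\<Lambda>1 \<le> \<Lambda>2"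
    and "a0 \<in> borel_measurable lebesgue"
    and "\<forall>h. h \<noteq> 0 \<longrightarrow> \<Lambda>1 \<le> a0 h \<and> a0 h \<le> \<Lambda>2"
  shows "\<exists>C1. \<forall>u f.
           u \<in> hoelder_space (\<lambda>r. \<phi> r * \<psi> r) \<and> vanishes_at_infinity u \<and>
           f \<in> hoelder_space \<psi> \<and>
           (\<forall>x. L0_defined a0 \<phi> u x \<and> L0 a0 \<phi> u x = f x)
           \<longrightarrow> hnorm (\<lambda>r. \<phi> r * \<psi> r) u \<le> C1 * (sup_norm u + hnorm \<psi> f)"
proof -
  define \<sigma> where "\<sigma> = (\<lambda>r. \<phi> r * \<psi> r)"
  have \<psi>_pos: "0 < \<psi> r" if "0 < r" "r \<le> 1" for r
    using assms(1) that by (simp add: admissible_modulus_def)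
  have \<phi>_pos: "0 < \<phi> r" if "0 < r" for r using assms(2) that by (simp add: admissible_order_def)
  have one: "\<phi> 1 = 1" "\<psi> 1 = 1"
    using assms(1,2) by (auto simp: admissible_modulus_def admissible_order_def)
  have \<sigma>_pos: "0 < \<sigma> r" if "0 < r" "r \<le> 1" for r unfolding \<sigma>_def using \<phi>_pos \<psi>_pos that by simp
  obtain \<delta>1 \<delta>2 a1 a2 where \<delta>: "0 < \<delta>1" "0 < a1" "1 \<le> a2"
    and scale: "\<And>lam r. 1 \<le> lam \<Longrightarrow> 0 < r \<Longrightarrow> a1 * lam powr (2*\<delta>1) * \<phi> r \<le> \<phi> (lam * r)"
      "\<And>lam r. 1 \<le> lam \<Longrightarrow> 0 < r \<Longrightarrow> \<phi> (lam * r) \<le> a2 * lam powr (2*\<delta>2) * \<phi> r"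
    using assms(2) unfolding admissible_order_def by blast
  have \<phi>_mono: "a1 * \<phi> r \<le> \<phi> (lam * r)" if "1 \<le> lam" "0 < r" for lam r
  proof -
    have "a1 * 1 * \<phi> r \<le> a1 * lam powr (2*\<delta>1) * \<phi> r"
      using that \<delta> \<phi>_pos[of r] by (intro mult_right_mono mult_left_mono ge_one_powr_ge_zero) auto
    then show ?thesis using scale(1)[OF that] by simp
  qed
  have \<phi>_B: "\<exists>B>0. \<forall>r>0. \<phi> (lam * r) \<le> B * \<phi> r" if "1 \<le> lam" for lam
    using scale(2)[OF that] \<delta> that by (intro exI[of _ "a2 * lam powr (2*\<delta>2)"]) auto

  have "lower_index \<psi> \<in> index_interval \<psi>"
    unfolding index_interval_def using lower_index_le_upper_index[OF \<psi>_pos] by simp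
  then have "0 < lower_index \<psi>" "lower_index \<psi> < 1" using assms(3) by auto
  then have ord\<psi>: "horder \<psi> = 0"
    by (intro horder_eq) (simp_all add: zero_ereal_def[symmetric] one_ereal_def[symmetric])

  have ends: "lower_index \<sigma> \<in> index_interval \<sigma>" "upper_index \<sigma> \<in> index_interval \<sigma>"
    unfolding index_interval_def using lower_index_le_upper_index[OF \<sigma>_pos] by simp_all
  \<comment> \<open>The index interval is connected and avoids 1 and 2, so both indices lie in the
    same open unit interval, whose left end is the order \<open>k\<close>.\<close>
  have not_mem: "ereal 1 \<notin> index_interval \<sigma>" "ereal 2 \<notin> index_interval \<sigma>"
    using assms(4) unfolding \<sigma>_def by auto
  have mem: "lower_index \<sigma> \<in> {0<..<1} \<union> {1<..<2} \<union> {2<..<3}" "upper_index \<sigma> \<in> {0<..<1} \<union> {1<..<2} \<union> {2<..<3}"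
    using assms(4) ends unfolding \<sigma>_def by blast+
  obtain k :: nat where k: "k \<le> 2" "ereal (real k) < lower_index \<sigma>" "upper_index \<sigma> < ereal (real k + 1)"
  proof -
    consider "lower_index \<sigma> \<in> {0<..<1}" | "lower_index \<sigma> \<in> {1<..<2}" | "lower_index \<sigma> \<in> {2<..<3}"
      using mem(1) by blast
    then show thesis
    proof cases
      case 1
      then have "upper_index \<sigma> < 1" using not_mem(1) by (auto simp: index_interval_def not_le simp flip: one_ereal_def)
      with 1 show thesis
        by (intro that[of 0]) (simp_all add: zero_ereal_def[symmetric] one_ereal_def[symmetric])
    next
      case 2
      then have "upper_index \<sigma> < 2" using not_mem(2) by (auto simp: index_interval_def)
      with 2 show thesis by (intro that[of 1]) (auto simp flip: one_ereal_def)
    next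
      case 3
      moreover have "upper_index \<sigma> < 3"
        using mem(2) by (auto intro: order.strict_trans)
      ultimately show thesis by (intro that[of 2]) auto
    qed
  qed
  have "lower_index \<sigma> \<le> ereal (real k + 1)"
    using lower_index_le_upper_index[OF \<sigma>_pos] k(3) by (meson order.trans less_imp_le)
  with k(2) have ord\<sigma>: "horder \<sigma> = k" by (rule horder_eq)
  define \<tau> where "\<tau> r = \<phi> r * \<psi> r * r powr (- real k)" for r
  obtain \<alpha> c where \<alpha>: "real k < \<alpha>" "0 < c"
    "\<And>r R. 0 < r \<Longrightarrow> r \<le> R \<Longrightarrow> R \<le> 1 \<Longrightarrow> c * (\<sigma> r / r powr \<alpha>) \<le> \<sigma> R / R powr \<alpha>"
    using less_lower_indexE[OF k(2)] by metis
  obtain \<beta> C where \<beta>: "\<beta> < real k + 1" "1 \<le> C"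
    "\<And>r R. 0 < r \<Longrightarrow> r \<le> R \<Longrightarrow> R \<le> 1 \<Longrightarrow> \<sigma> R / R powr \<beta> \<le> C * (\<sigma> r / r powr \<beta>)"
    using upper_index_lessE[OF k(3)] by metis
  \<comment> \<open>Written with \<open>s = \<alpha>\<close> this yields growth of order
    \<open>\<alpha> - k > 0\<close>, and with \<open>s = \<beta>\<close> the upper bound of order
    \<open>\<beta> - k < 1\<close>.\<close>
  have \<tau>: "\<tau> r = \<sigma> r / r powr s * r powr (s - real k)" if "0 < r" for r s
    using that by (simp add: \<tau>_def \<sigma>_def powr_diff powr_minus_divide)
  have inc: "\<tau> r \<le> (1 / c) * (r / R) powr (\<alpha> - real k) * \<tau> R" if "0 < r" "r \<le> R" "R \<le> 1" for r R
  proof -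
    have "\<sigma> r / r powr \<alpha> \<le> \<sigma> R / R powr \<alpha> / c" 
      using \<alpha>(3)[OF that] \<alpha>(2) by (metis mult.commute pos_le_divide_eq)
    then have "\<tau> r \<le> \<sigma> R / R powr \<alpha> / c * r powr (\<alpha> - real k)"
      unfolding \<tau>[OF that(1), of \<alpha>] by (intro mult_right_mono) auto
    also have "\<dots> = (1 / c) * (r / R) powr (\<alpha> - real k) * \<tau> R"
      using that by (simp add: \<tau>[of R \<alpha>] powr_divide ac_simps)
    finally show ?thesis .
  qed
  have dec: "\<tau> R \<le> C * (R / r) powr (\<beta> - real k) * \<tau> r" if "0 < r" "r \<le> R" "R \<le> 1" for r R
  proof -
    have "\<tau> R \<le> C * (\<sigma> r / r powr \<beta>) * R powr (\<beta> - real k)"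
      unfolding \<tau>[OF order.strict_trans2[OF that(1,2)], of \<beta>] by (intro mult_right_mono \<beta>(3)[OF that]) simp
    also have "\<dots> = C * (R / r) powr (\<beta> - real k) * \<tau> r"
      using that by (simp add: \<tau>[of r \<beta>] powr_divide ac_simps)
    finally show ?thesis .
  qed
  have a0: "\<Lambda>1 \<le> a0 h" if "h \<noteq> 0" for h using assms(8) that by blast
  have cs: "0 < 1 / c" "0 < \<alpha> - real k" "0 < C" "\<beta> - real k < 1" using \<alpha> \<beta> by auto
  have "\<exists>K\<ge>0. \<forall>u f bs F U. solves a0 \<phi> u f \<longrightarrow> pdiff bs u \<longrightarrow> set bs \<subseteq> Basis \<longrightarrow> length bs = k \<longrightarrow>
    (\<forall>x. \<bar>u x\<bar> \<le> U) \<longrightarrow> 0 \<le> F \<longrightarrow>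
    (\<forall>x h. 0 < norm h \<longrightarrow> norm h \<le> 1 \<longrightarrow> \<bar>f (x + h) - f x\<bar> \<le> F * \<psi> (norm h)) \<longrightarrow>
    bdd_above (hq_set \<sigma> k (Dl bs u)) \<longrightarrow>
    hseminorm \<sigma> k (Dl bs u) \<le> K * (U + F) \<and> (\<forall>x. \<bar>Dl bs u x\<bar> \<le> K * (U + F))"
    unfolding \<sigma>_def
    by (rule hseminorm_schauder[where c="1 / c" and \<gamma>="\<alpha> - real k" and C=C and \<beta>="\<beta> - real k"])
       (fact \<phi>_pos \<phi>_mono \<delta>(2) \<phi>_B \<psi>_pos one a0 assms(5) inc[unfolded \<tau>_def] dec[unfolded \<tau>_def] cs)+
  then obtain K where K: "0 \<le> K"
    and est: "\<forall>u f bs F U. solves a0 \<phi> u f \<longrightarrow> pdiff bs u \<longrightarrow> set bs \<subseteq> Basis \<longrightarrow> length bs = k \<longrightarrow>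
    (\<forall>x. \<bar>u x\<bar> \<le> U) \<longrightarrow> 0 \<le> F \<longrightarrow>
    (\<forall>x h. 0 < norm h \<longrightarrow> norm h \<le> 1 \<longrightarrow> \<bar>f (x + h) - f x\<bar> \<le> F * \<psi> (norm h)) \<longrightarrow>
    bdd_above (hq_set \<sigma> k (Dl bs u)) \<longrightarrow>
    hseminorm \<sigma> k (Dl bs u) \<le> K * (U + F) \<and> (\<forall>x. \<bar>Dl bs u x\<bar> \<le> K * (U + F))"
    by (elim exE conjE) (rule that)
  show ?thesis unfolding \<sigma>_def[symmetric]
  proof (intro exI allI impI, elim conjE)
    fix u f
    assume u: "u \<in> hoelder_space \<sigma>" and van: "vanishes_at_infinity u" and f: "f \<in> hoelder_space \<psi>"
      and L: "\<forall>x. L0_defined a0 \<phi> u x \<and> L0 a0 \<phi> u x = f x"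
    define U where "U = sup_norm u"
    define F where "F = hseminorm \<psi> 0 f"
    have sol: "solves a0 \<phi> u f" using van L by (simp add: solves_def)
    have Ub: "\<bar>u x\<bar> \<le> U" for x unfolding U_def by (rule abs_le_sup_norm[OF u])
    have U0: "0 \<le> U" using Ub[of 0] by linarith
    have Fb: "\<bar>f (x + h) - f x\<bar> \<le> F * \<psi> (norm h)" if "0 < norm h" "norm h \<le> 1" for x h
      unfolding F_def by (rule hseminorm_0_bound[OF f ord\<psi> \<psi>_pos that])
    obtain b :: 'a where b: "b \<in> Basis" using nonempty_Basis by blast
    \<comment> \<open>A basis vector has norm 1 and \<open>\<psi> 1 = 1\<close>, so \<open>F\<close>
      itself bounds an absolute value.\<close>
    have F0: "0 \<le> F" using order_trans[OF abs_ge_zero Fb[of b 0]] b one by simp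
    have "F \<le> hnorm \<psi> f"
      using order_trans[OF abs_ge_zero abs_le_sup_norm[OF f, of 0]]
      by (simp add: hnorm_horder_0[OF ord\<psi>] F_def)
    then have UF: "U + F \<le> sup_norm u + hnorm \<psi> f" by (simp add: U_def)
    have top: "hseminorm \<sigma> k (Dl bs u) \<le> K * (U + F)" "\<bar>Dl bs u x\<bar> \<le> K * (U + F)"
      if bs: "set bs \<subseteq> Basis" "length bs = k" for bs x
    proof -
      have pd: "pdiff bs u" using hoelder_space_pdiff[OF u bs(1)] bs(2) ord\<sigma> by simp
      have bdd: "bdd_above (hq_set \<sigma> k (Dl bs u))"
        using hoelder_space_bdd_hq_set[OF u bs(1)] bs(2) ord\<sigma> by simp
      show "hseminorm \<sigma> k (Dl bs u) \<le> K * (U + F)"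
        by (rule est[rule_format, THEN conjunct1]) (fact sol pd bs Ub F0 Fb bdd)+
      show "\<bar>Dl bs u x\<bar> \<le> K * (U + F)"
        by (rule est[rule_format, THEN conjunct2, THEN spec]) (fact sol pd bs Ub F0 Fb bdd)+
    qed
    have below: "\<bar>Dl bs u x\<bar> \<le> (K + 2) * (U + F)" if bs: "set bs \<subseteq> Basis" "length bs \<le> k" for bs x
    proof -
      have le: "K * (U + F) \<le> (K + 2) * (U + F)" "U \<le> (K + 2) * (U + F)"
        using U0 F0 K mult_nonneg_nonneg[of K "U + F"] by (simp_all add: distrib_right)
      \<comment> \<open>Since \<open>k \<le> 2\<close>, the only order strictly between 0 and
        \<open>k\<close> is 1, and it occurs only for \<open>k = 2\<close>.\<close>
      have "length bs = k \<or> length bs = 0 \<or> length bs = 1 \<and> k = 2" using bs(2) k(1) by arith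
      then consider "length bs = k" | "bs = []" | "length bs = 1" "k = 2"
        by auto
      then show ?thesis
      proof cases
        case 1
        then show ?thesis using top(2)[OF bs(1) 1, of x] le by linarith
      next
        case 2
        then show ?thesis using Ub[of x] le by simp
      next
        case 3
        then obtain e where e: "bs = [e]" "e \<in> Basis" using bs(1) by (auto simp: length_Suc_conv)
        have "pdiff [e, e] u" using hoelder_space_pdiff[OF u, of "[e, e]"] e ord\<sigma> 3 by simp
        then have D: "\<And>x. has_pderiv e u x" "\<And>x. has_pderiv e (pderiv e u) x" by auto
        \<comment> \<open>Interpolation by two mean values: the first derivative at some point
          within distance 1 is a difference of two values of \<open>u\<close>, and moving it back to
          \<open>x\<close> costs at most the pure second derivative in the same direction. This
          accounts for \<open>K + 2\<close>.\<close>
        obtain s where s: "0 < s" "s < 1" "shift_diff (1 *\<^sub>R e) u x = 1 * pderiv e u (x + s *\<^sub>R e)"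
          using shift_diff_mvt[of e u 1 x, OF D(1) zero_less_one] by blast
        obtain s' where s': "shift_diff (s *\<^sub>R e) (pderiv e u) x = s * pderiv e (pderiv e u) (x + s' *\<^sub>R e)"
          using shift_diff_mvt[of e "pderiv e u" s x, OF D(2) s(1)] by blast
        have t: "\<bar>pderiv e (pderiv e u) (x + s' *\<^sub>R e)\<bar> \<le> K * (U + F)"
          using top(2)[of "[e, e]"] e 3 by simp
        have "\<bar>s * pderiv e (pderiv e u) (x + s' *\<^sub>R e)\<bar> \<le> 1 * (K * (U + F))"
          unfolding abs_mult using s t by (intro mult_mono) auto
        then have "\<bar>pderiv e u x\<bar> \<le> \<bar>u (x + e)\<bar> + \<bar>u x\<bar> + K * (U + F)"
          using s(3) s' unfolding shift_diff_def by simp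
        also have "\<dots> \<le> (K + 2) * (U + F)" using Ub[of x] Ub[of "x + e"] F0 by (simp add: algebra_simps)
        finally show ?thesis by (simp add: e)
      qed
    qed
    have "hnorm \<sigma> u \<le> (real (horder \<sigma>) + 2) * ((K + 2) * (U + F))"
    proof (rule hnorm_le)
      fix bs :: "'a list" assume bs: "set bs \<subseteq> Basis" "length bs = horder \<sigma>"
      have "K * (U + F) \<le> (K + 2) * (U + F)" using U0 F0 by (intro mult_right_mono) auto
      then show "hseminorm \<sigma> (horder \<sigma>) (Dl bs u) \<le> (K + 2) * (U + F)"
        using top(1)[of bs] bs ord\<sigma> by simp
    qed (use below ord\<sigma> in auto)
    also have "\<dots> = ((real k + 2) * (K + 2)) * (U + F)" by (simp add: ord\<sigma>)
    also have "\<dots> \<le> ((real k + 2) * (K + 2)) * (sup_norm u + hnorm \<psi> f)"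
      using UF K by (intro mult_left_mono) auto
    finally show "hnorm \<sigma> u \<le> ((real k + 2) * (K + 2)) * (sup_norm u + hnorm \<psi> f)" .
  qed
qed

end
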